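(* Let $\tilde{\mathbf X}=[\mathbf X:-\mathbf X]$. The forward stagewise algorithm for the dataset $\tilde{\mathbf X}$ with squared-error loss computes the monotone lasso path $\beta(\ell)$, i.e. the solution of $$\frac{\partial\beta}{\partial\ell}=\rho_{ml}(\beta(\ell)),\qquad\beta(0)=0 .$$ It starts at $0$ and increments the coefficients continuously according to the monotone lasso moves $\rho_{ml}$. Specifically, the path is obtained as follows. Initialize: set $\beta(0)=0$, $\ell_0=0$ and $\rho_0=\rho_{ml}(0)$, with corresponding active set $\mathcal A_0$. For $j=0,1,2,\dots$: 1. Let $\beta(\ell)=\beta(\ell_j)+(\ell-\ell_j)\cdot\rho_j$ for $\ell\in[\ell_j,\ell_{j+1}]$, where $\ell_{j+1}$ is the value of $\ell>\ell_j$ at which $\mathcal A_j$ changes to $\mathcal A_{j+1}$. 2. Compute $\rho_{j+1}=\rho_{ml}(\beta(\ell_{j+1}))$. 3. If $\rho_{j+1}=0$, exit; then $\beta(\ell)$ is defined on $[0,L]$ with $L=\ell_{j+1}$.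
   Context: $\mathbf X$ is an $N\times p$ real matrix whose columns are standardized to have mean zero and a common variance, $\mathbf y\in\mathbb{R}^N$ is a centered response, and $\tilde{\mathbf X}=[\mathbf X:-\mathbf X]$ has columns $\tilde{\mathbf x}_1,\dots,\tilde{\mathbf x}_{2p}$. Because of the standardization, correlations with a residual $\mathbf r$ are compared through inner products $\tilde{\mathbf x}_j^T\mathbf r$. Active set at $\beta\in\mathbb{R}^{2p}$: with $\mathbf r=\mathbf y-\tilde{\mathbf X}\beta$, $\mathcal A=\{j:\tilde{\mathbf x}_j^T\mathbf r=\max_k\tilde{\mathbf x}_k^T\mathbf r\}$. In the recursion, $\mathcal A_j$ is the active set at $\beta(\ell_j)$, and it "changes" at the first $\ell>\ell_j$ at which a variable not in $\mathcal A_j$ attains the maximal correlation with the current residual $\mathbf y-\tilde{\mathbf X}\beta(\ell)$ (this includes the case where all correlations with the residual become zero). Monotone lasso move direction: $\rho_{ml}(\beta)=0$ if $\tilde{\mathbf X}^T\mathbf r=0$; otherwise $\rho_{ml}(\beta)=\theta/\sum_j\theta_j$, where $\theta_j=0$ for $j\notin\mathcal A$ and $\theta_{\mathcal A}$ is the non-negative least squares coefficient of $\mathbf r$ on $\tilde{\mathbf X}_{\mathcal A}$, i.e. the minimizer (assumed unique) of $\|\mathbf r-\tilde{\mathbf X}_{\mathcal A}\theta_{\mathcal A}\|_2^2$ subject to $\theta_j\ge0$ for all $j\in\mathcal A$. Monotone lasso path: the continuous, piecewise differentiable curve $\beta(\ell)$ with $\beta(0)=0$ solving the differential equation $\partial\beta/\partial\ell=\rho_{ml}(\beta(\ell))$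 (with the equation understood away from the breakpoints where the derivative jumps). It is parametrized by $L_1$ arc-length since $\rho_{ml}$ has unit $L_1$ norm when nonzero. Forward stagewise algorithm: the limit, as $\epsilon\downarrow0$, of the following procedure, with its path indexed by total distance stepped $\ell=m\epsilon$ ($m$ = number of steps). Start with $\mathbf r=\mathbf y$ and $\beta=0\in\mathbb{R}^{2p}$; repeatedly find the predictor $\tilde{\mathbf x}_j$ most positively correlated with $\mathbf r$ and update $\beta_j\leftarrow\beta_j+\epsilon$, $\mathbf r\leftarrow\mathbf r-\epsilon\tilde{\mathbf x}_j$, until no predictor has any correlation with $\mathbf r$. *)

theory Defs
  imports "HOL-Analysis.Analysis"
begin

definition mean :: "real ^ 'n \<Rightarrow> real" where
  "mean v = (\<Sum>i\<in>UNIV. v $ i) / real CARD('n)"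

definition variance :: "real ^ 'n \<Rightarrow> real" where
  "variance v = (\<Sum>i\<in>UNIV. (v $ i - mean v)\<^sup>2) / real CARD('n)"

definition standardized :: "real ^ 'p ^ 'n \<Rightarrow> bool" where
  "standardized X \<longleftrightarrow>
     (\<forall>j. mean (column j X) = 0) \<and> (\<exists>s. \<forall>j. variance (column j X) = s)"

text \<open>The expanded matrix \<open>[X : -X]\<close>: the columns of \<open>X\<close> are indexed by \<open>Inl\<close>, their negatives
  by \<open>Inr\<close>.\<close>

definition expand :: "real ^ 'p ^ 'n \<Rightarrow> real ^ ('p + 'p) ^ 'n" where
  "expand X = (\<chi> i k. case k of Inl j \<Rightarrow> X $ i $ j | Inr j \<Rightarrow> - X $ i $ j)"

definition residual :: "real ^ 'p ^ 'n \<Rightarrow> real ^ 'n \<Rightarrow> real ^ ('p + 'p) \<Rightarrow> real ^ 'n" where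
  "residual X y \<beta> = y - expand X *v \<beta>"

definition uncorrelated :: "real ^ 'p ^ 'n \<Rightarrow> real ^ 'n \<Rightarrow> bool" where
  "uncorrelated X r \<longleftrightarrow> transpose (expand X) *v r = 0"

text \<open>As the columns are standardized, correlations with a common vector \<open>r\<close> are compared through
  inner products.\<close>

definition most_correlated :: "real ^ 'p ^ 'n \<Rightarrow> real ^ 'n \<Rightarrow> ('p + 'p) set" where
  "most_correlated X r =
     {j. column j (expand X) \<bullet> r = Max (range (\<lambda>k. column k (expand X) \<bullet> r))}"

definition active_set :: "real ^ 'p ^ 'n \<Rightarrow> real ^ 'n \<Rightarrow> real ^ ('p + 'p) \<Rightarrow> ('p + 'p) set" where
  "active_set X y \<beta> = most_correlated X (residual X y \<beta>)"

text \<open>Non-negative least squares on the active columns.  A coefficient vector on the active set is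
  represented by its extension by zero.\<close>

definition is_nnls ::
  "real ^ 'p ^ 'n \<Rightarrow> real ^ 'n \<Rightarrow> real ^ ('p + 'p) \<Rightarrow> real ^ ('p + 'p) \<Rightarrow> bool" where
  "is_nnls X y \<beta> =
     is_arg_min (\<lambda>\<theta>. (norm (residual X y \<beta> - expand X *v \<theta>))\<^sup>2)
       (\<lambda>\<theta>. (\<forall>j\<in>active_set X y \<beta>. \<theta> $ j \<ge> 0) \<and> (\<forall>j. j \<notin> active_set X y \<beta> \<longrightarrow> \<theta> $ j = 0))"

definition nnls_unique :: "real ^ 'p ^ 'n \<Rightarrow> real ^ 'n \<Rightarrow> bool" where
  "nnls_unique X y \<longleftrightarrow>
     (\<forall>\<beta>. \<not> uncorrelated X (residual X y \<beta>) \<longrightarrow> (\<exists>\<^sub>\<le>\<^sub>1\<theta>. is_nnls X y \<beta> \<theta>))"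

definition \<rho>_ml :: "real ^ 'p ^ 'n \<Rightarrow> real ^ 'n \<Rightarrow> real ^ ('p + 'p) \<Rightarrow> real ^ ('p + 'p)" where
  "\<rho>_ml X y \<beta> =
     (if uncorrelated X (residual X y \<beta>) then 0
      else let \<theta> = (THE \<theta>. is_nnls X y \<beta> \<theta>) in (1 / (\<Sum>j\<in>UNIV. \<theta> $ j)) *\<^sub>R \<theta>)"

text \<open>Solutions on \<open>[0, L]\<close> of the differential equation, required to hold away from finitely many
  breakpoints; in particular \<open>\<beta>\<close> is piecewise differentiable.\<close>

definition monotone_lasso_path ::
  "real ^ 'p ^ 'n \<Rightarrow> real ^ 'n \<Rightarrow> real \<Rightarrow> (real \<Rightarrow> real ^ ('p + 'p)) \<Rightarrow> bool" where
  "monotone_lasso_path X y L \<beta> \<longleftrightarrow>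
     0 \<le> L \<and> continuous_on {0..L} \<beta> \<and> \<beta> 0 = 0 \<and>
     (\<exists>S. finite S \<and>
        (\<forall>l\<in>{0..L} - S. (\<beta> has_vector_derivative \<rho>_ml X y (\<beta> l)) (at l within {0..L})))"

text \<open>A run of the incremental procedure with step size \<open>\<epsilon>\<close>: \<open>b m\<close> and \<open>r m\<close> are the coefficients
  and the residual after \<open>m\<close> steps.  Ties are broken arbitrarily.  A run that stops is continued as
  a constant sequence.\<close>

definition stagewise_run ::
  "real ^ 'p ^ 'n \<Rightarrow> real ^ 'n \<Rightarrow> real \<Rightarrow> (nat \<Rightarrow> real ^ ('p + 'p)) \<Rightarrow> (nat \<Rightarrow> real ^ 'n) \<Rightarrow> bool" where
  "stagewise_run X y \<epsilon> b r \<longleftrightarrow>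
     b 0 = 0 \<and> r 0 = y \<and>
     (\<forall>m. if uncorrelated X (r m) then b (Suc m) = b m \<and> r (Suc m) = r m
          else \<exists>j\<in>most_correlated X (r m).
                 b (Suc m) = b m + axis j \<epsilon> \<and>
                 r (Suc m) = r m - \<epsilon> *\<^sub>R column j (expand X))"

text \<open>The limiting path as the step size tends to zero, indexed by the distance \<open>l = m * \<epsilon>\<close> stepped,
  whatever the way ties are broken.  It ends at the first \<open>L\<close> at which no predictor is correlated
  with the residual.  For a fixed \<open>\<epsilon>\<close> the procedure need not stop at all (it may keep oscillating
  around a least squares fit), so the stopping rule is imposed on the limit.\<close>

definition forward_stagewise_path ::
  "real ^ 'p ^ 'n \<Rightarrow> real ^ 'n \<Rightarrow> real \<Rightarrow> (real \<Rightarrow> real ^ ('p + 'p)) \<Rightarrow> bool" where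
  "forward_stagewise_path X y L \<beta> \<longleftrightarrow>
     0 \<le> L \<and>
     (\<forall>b r. (\<forall>\<epsilon>>0. stagewise_run X y \<epsilon> (b \<epsilon>) (r \<epsilon>)) \<longrightarrow>
        uniform_limit {0..L} (\<lambda>\<epsilon> l. b \<epsilon> (nat \<lfloor>l / \<epsilon>\<rfloor>)) \<beta> (at_right 0)) \<and>
     (\<forall>l\<in>{0..<L}. \<not> uncorrelated X (residual X y (\<beta> l))) \<and>
     uncorrelated X (residual X y (\<beta> L))"

text \<open>The piecewise linear recursion, which exits after \<open>K\<close> segments.  The case \<open>K = 0\<close> occurs if
  \<open>y\<close> is already uncorrelated with all predictors.  Members of \<open>A j\<close> may drop out of the active set
  inside a segment; only an entering variable ends the segment.\<close>

definition stagewise_recursion ::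
  "real ^ 'p ^ 'n \<Rightarrow> real ^ 'n \<Rightarrow> nat \<Rightarrow> (nat \<Rightarrow> real) \<Rightarrow> (nat \<Rightarrow> real ^ ('p + 'p)) \<Rightarrow>
     (nat \<Rightarrow> ('p + 'p) set) \<Rightarrow> real \<Rightarrow> (real \<Rightarrow> real ^ ('p + 'p)) \<Rightarrow> bool" where
  "stagewise_recursion X y K l \<rho> A L \<beta> \<longleftrightarrow>
     \<beta> 0 = 0 \<and> l 0 = 0 \<and>
     (\<forall>j\<le>K. \<rho> j = \<rho>_ml X y (\<beta> (l j)) \<and> A j = active_set X y (\<beta> (l j))) \<and>
     (\<forall>j<K. \<rho> j \<noteq> 0 \<and> l j < l (Suc j) \<and>
        (\<forall>t\<in>{l j..l (Suc j)}. \<beta> t = \<beta> (l j) + (t - l j) *\<^sub>R \<rho> j) \<and>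
        (\<forall>t\<in>{l j<..<l (Suc j)}. active_set X y (\<beta> t) \<subseteq> A j) \<and>
        \<not> active_set X y (\<beta> (l (Suc j))) \<subseteq> A j) \<and>
     \<rho> K = 0 \<and> L = l K"

end

(* The max-correlation corr r = max_k x_k . r is a convex function of the residual r, and
   its subdifferential at r is the convex hull of the active predictors.  When corr r > 0, a
   non-negative least squares fit of r on the active predictors, normalised to total weight one,
   gives exactly the point of least norm in this hull.  So the residual of a monotone lasso path
   follows the gradient flow of corr, while a stagewise run is a subgradient method for corr.

   Monotonicity of the subdifferential makes the flow unique and bounds the squared distance
   between flow and run at time t by a constant times epsilon * t.  The coefficients of the run
   converge too, because its increments over a segment of the path, divided by the distance
   stepped, are weights on the active set that reproduce the slope of the residual, and uniqueness
   of the least squares fit leaves only one such choice.  The recursion ends because each entering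
   predictor strictly decreases the least norm, which depends on the active set only. *)

theory Submission
  imports Defs
begin

section \<open>Differential inequalities, polygonal curves and step counts\<close>

text \<open>Two obstacles shape the proof. The move direction jumps where the active set changes, so
  Lipschitz arguments give neither uniqueness nor convergence; monotonicity has to replace them. And
  the coefficients are not a function of the residual, since the columns of [X : -X] are linearly
  dependent: closeness of residuals says nothing by itself about coefficients. Uniqueness of the fit
  removes this ambiguity only among weights supported on one active set, at a residual with nonzero
  maximal correlation. As a new predictor is active at the end of a segment, coefficients are
  compared strictly inside a segment only; the margins left at its two ends are harmless because run
  and path both move with at most unit speed.\<close>

lemma increment_le:
  fixes f f' :: "real \<Rightarrow> real"
  assumes "finite S" "a \<le> b" "continuous_on {a..b} f"
    and deriv: "\<And>t. t \<in> {a<..<b} - S \<Longrightarrow> (f has_vector_derivative f' t) (at t)"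
    and le: "\<And>t. t \<in> {a<..<b} - S \<Longrightarrow> f' t \<le> C"
  shows "f b - f a \<le> C * (b - a)"
proof -
  \<comment> \<open>At the exceptional points the integrand is set to the bound itself, so that the
    final comparison holds everywhere on the interval.\<close>
  let ?g = "\<lambda>t. if t \<in> {a<..<b} - S then f' t else C"
  have "(?g has_integral f b - f a) {a..b}"
    by (rule fundamental_theorem_of_calculus_interior_strong[OF assms(1,2) _ assms(3)])
      (use deriv in auto)
  moreover have "((\<lambda>_. C) has_integral C * (b - a)) {a..b}"
    using has_integral_const_real[of C a b] assms(2) by (simp add: mult.commute)
  ultimately show ?thesis
    by (rule has_integral_le) (use le in auto)
qed

lemma norm_increment_le:
  fixes f :: "real \<Rightarrow> 'v::euclidean_space"
  assumes "finite S" "a \<le> b" "continuous_on {a..b} f"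
    and deriv: "\<And>t. t \<in> {a<..<b} - S \<Longrightarrow> (f has_vector_derivative f' t) (at t)"
    and le: "\<And>t. t \<in> {a<..<b} - S \<Longrightarrow> norm (f' t) \<le> C"
  shows "norm (f b - f a) \<le> C * (b - a)"
proof (cases "f b - f a = 0")
  case True
  then show ?thesis
  \<comment> \<open>What remains is \<open>0 \<le> C * (b - a)\<close>. The bound at any admissible
    point gives the sign of \<open>C\<close>; if there is none, the open interval lies in a finite
    set and is therefore empty.\<close>
  proof (cases "{a<..<b} - S = {}")
    case True
    then have "\<not> a < b" using assms(1) infinite_Ioo[of a b] finite_subset[of "{a<..<b}" S] by blast
    then show ?thesis using \<open>f b - f a = 0\<close> assms(2) by simp
  next
    case False
    then have "0 \<le> C" using le norm_ge_zero order_trans by blast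
    then show ?thesis using \<open>f b - f a = 0\<close> assms(2) by simp
  qed
next
  case False
  define u where "u = f b - f a"
  have "(f b \<bullet> u) - (f a \<bullet> u) \<le> (C * norm u) * (b - a)"
  proof (rule increment_le[OF assms(1,2)])
    show "continuous_on {a..b} (\<lambda>t. f t \<bullet> u)" by (intro continuous_intros assms(3))
    fix t assume t: "t \<in> {a<..<b} - S"
    show "((\<lambda>t. f t \<bullet> u) has_vector_derivative f' t \<bullet> u) (at t)"
      by (rule bounded_linear.has_vector_derivative[OF bounded_linear_inner_left deriv[OF t]])
    show "f' t \<bullet> u \<le> C * norm u"
      using norm_cauchy_schwarz[of "f' t" u] mult_right_mono[OF le[OF t], of "norm u"] by simp
  qed
  then have "norm u * norm u \<le> (C * (b - a)) * norm u"
    unfolding inner_diff_left[symmetric] u_def[symmetric]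
    by (simp only: power2_norm_eq_inner[symmetric] power2_eq_square mult_ac)
  then show ?thesis using False by (simp add: u_def)
qed

lemma nat_floor_bounds:
  fixes t \<epsilon> :: real
  assumes "0 < \<epsilon>" "0 \<le> t"
  shows "real (nat \<lfloor>t / \<epsilon>\<rfloor>) * \<epsilon> \<le> t" "t < real (nat \<lfloor>t / \<epsilon>\<rfloor>) * \<epsilon> + \<epsilon>"
proof -
  have "0 \<le> t / \<epsilon>" using assms by simp
  then have "real (nat \<lfloor>t / \<epsilon>\<rfloor>) \<le> t / \<epsilon>" "t / \<epsilon> < real (nat \<lfloor>t / \<epsilon>\<rfloor>) + 1" by linarith+
  then show "real (nat \<lfloor>t / \<epsilon>\<rfloor>) * \<epsilon> \<le> t" "t < real (nat \<lfloor>t / \<epsilon>\<rfloor>) * \<epsilon> + \<epsilon>"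
    using assms(1) by (auto simp: field_simps)
qed

text \<open>The curve is a sum of clipped displacements: the summand of a segment grows while
  \<open>t\<close> crosses that segment and is constant elsewhere. Continuity is then immediate,
  with no gluing at the breakpoints.\<close>

lemma polygonal_curve:
  fixes l :: "nat \<Rightarrow> real" and v :: "nat \<Rightarrow> 'v::real_normed_vector"
  assumes mono: "\<And>j. j < K \<Longrightarrow> l j \<le> l (Suc j)" and "l 0 = 0"
  obtains \<beta> where "\<beta> 0 = 0" "continuous_on UNIV \<beta>"
    "\<And>j t. j < K \<Longrightarrow> t \<in> {l j..l (Suc j)} \<Longrightarrow> \<beta> t = \<beta> (l j) + (t - l j) *\<^sub>R v j"
proof
  define \<beta> where "\<beta> t = (\<Sum>j<K. (max (l j) (min t (l (Suc j))) - l j) *\<^sub>R v j)" for t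
  have le: "l i \<le> l j" if "i \<le> j" "j \<le> K" for i j
    using that
  proof (induction rule: dec_induct)
    case (step n)
    then show ?case using mono[of n] by simp
  qed simp
  show "\<beta> 0 = 0"
    unfolding \<beta>_def
  proof (intro sum.neutral ballI)
    fix i assume "i \<in> {..<K}"
    then have "0 \<le> l i" using le[of 0 i] \<open>l 0 = 0\<close> by simp
    then show "(max (l i) (min 0 (l (Suc i))) - l i) *\<^sub>R v i = 0" by (simp add: max_def min_def)
  qed
  show "continuous_on UNIV \<beta>"
    unfolding \<beta>_def by (intro continuous_intros)
  fix j t assume j: "j < K" and t: "t \<in> {l j..l (Suc j)}"
  have "\<beta> t - \<beta> (l j) = (\<Sum>i<K. if i = j then (t - l j) *\<^sub>R v j else 0)"
    unfolding \<beta>_def sum_subtractf[symmetric]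
  proof (rule sum.cong)
    fix i assume i: "i \<in> {..<K}"
    have "l (Suc i) \<le> l j" if "i < j" using le[of "Suc i" j] that j by simp
    moreover have "l (Suc j) \<le> l i" if "j < i" using le[of "Suc j" i] that i by simp
    ultimately show "(max (l i) (min t (l (Suc i))) - l i) *\<^sub>R v i -
        (max (l i) (min (l j) (l (Suc i))) - l i) *\<^sub>R v i =
        (if i = j then (t - l j) *\<^sub>R v j else 0)"
      using t mono[of i] i by (cases i j rule: linorder_cases) (auto simp: max_def min_def)
  qed simp
  also have "\<dots> = (t - l j) *\<^sub>R v j" using j by simp
  finally show "\<beta> t = \<beta> (l j) + (t - l j) *\<^sub>R v j" by (simp add: algebra_simps)
qed

lemma breakpoint_interval:
  fixes l :: "nat \<Rightarrow> real"
  assumes "l 0 \<le> t" "t < l K"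
  shows "\<exists>j<K. l j \<le> t \<and> t < l (Suc j)"
  using assms(2)
proof (induction K)
  case 0
  then show ?case using assms(1) by simp
next
  case (Suc K)
  show ?case
  proof (cases "t < l K")
    case True
    then show ?thesis using Suc.IH less_SucI by blast
  next
    case False
    then show ?thesis using Suc.prems by (intro exI[of _ K]) simp
  qed
qed

lemma floor_mult_tendsto:
  fixes t :: real
  assumes "0 \<le> t"
  shows "((\<lambda>\<epsilon>. real (nat \<lfloor>t / \<epsilon>\<rfloor>) * \<epsilon>) \<longlongrightarrow> t) (at_right 0)"
proof (rule tendsto_sandwich)
  have "\<forall>\<^sub>F \<epsilon> in at_right (0::real). 0 < \<epsilon>" by (rule eventually_at_right_less)
  then show "\<forall>\<^sub>F \<epsilon> in at_right 0. t - \<epsilon> \<le> real (nat \<lfloor>t / \<epsilon>\<rfloor>) * \<epsilon>"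
    "\<forall>\<^sub>F \<epsilon> in at_right 0. real (nat \<lfloor>t / \<epsilon>\<rfloor>) * \<epsilon> \<le> t"
    using nat_floor_bounds[OF _ assms] by (force elim: eventually_mono)+
  show "((\<lambda>\<epsilon>. t - \<epsilon>) \<longlongrightarrow> t) (at_right 0)"
    by (rule tendsto_eq_intros refl)+ simp
qed simp

section \<open>The maximal correlation and its subdifferential\<close>

text \<open>What is kept of [X : -X] is that its columns are closed under negation. This makes the
  maximal correlation non-negative, and zero exactly when no predictor is correlated with the
  residual.\<close>

locale symmetric_predictors =
  fixes x :: "'k::finite \<Rightarrow> 'a::euclidean_space"
  assumes neg_predictor: "\<exists>k'. x k' = - x k"
begin

definition comb :: "real ^ 'k \<Rightarrow> 'a" where
  "comb c = (\<Sum>k\<in>UNIV. c $ k *\<^sub>R x k)"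

definition corr :: "'a \<Rightarrow> real" where
  "corr r = Max (range (\<lambda>k. x k \<bullet> r))"

definition active :: "'a \<Rightarrow> 'k set" where
  "active r = {k. x k \<bullet> r = corr r}"

definition weights :: "'k set \<Rightarrow> (real ^ 'k) set" where
  "weights A = {c. (\<forall>k. 0 \<le> c $ k) \<and> (\<forall>k. k \<notin> A \<longrightarrow> c $ k = 0) \<and> (\<Sum>k\<in>UNIV. c $ k) = 1}"

text \<open>The optimality condition for \<open>comb c\<close> to be the point of least norm in the convex hull
  of the predictors in \<open>A\<close>.\<close>

definition steepest :: "'k set \<Rightarrow> real ^ 'k \<Rightarrow> bool" where
  "steepest A c \<longleftrightarrow> c \<in> weights A \<and> (\<forall>k\<in>A. comb c \<bullet> comb c \<le> x k \<bullet> comb c)"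

text \<open>The move direction without least squares: the optimality condition for the normalised
  weights replaces the fit and its scale factor. The description is meaningful where
  \<open>steepest\<close> has one solution, which \<open>stagewise_problem\<close> provides at the
  residuals \<open>y - comb b\<close>.\<close>

definition direction :: "'a \<Rightarrow> real ^ 'k" where
  "direction r = (if corr r = 0 then 0 else THE c. steepest (active r) c)"

lemma linear_comb: "linear comb"
  unfolding comb_def
  by (rule linearI) (auto simp: scaleR_add_left sum.distrib scaleR_sum_right)

lemmas comb_simps = linear_add[OF linear_comb] linear_diff[OF linear_comb]
  linear_scale[OF linear_comb] linear_0[OF linear_comb]

lemma bounded_linear_comb: "bounded_linear comb"
  by (simp add: linear_comb linear_conv_bounded_linear[symmetric])

lemma comb_axis: "comb (axis k e) = e *\<^sub>R x k"
proof -
  have "comb (axis k e) = (\<Sum>j\<in>UNIV. if j = k then e *\<^sub>R x k else 0)"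
    unfolding comb_def by (rule sum.cong) (auto simp: axis_def)
  then show ?thesis by simp
qed

lemma inner_comb: "comb c \<bullet> v = (\<Sum>k\<in>UNIV. c $ k * (x k \<bullet> v))"
  by (simp add: comb_def inner_sum_left)

lemma inner_le_corr: "x k \<bullet> r \<le> corr r"
  by (simp add: corr_def)

lemma corr_attained: "\<exists>k. x k \<bullet> r = corr r"
proof -
  have "corr r \<in> range (\<lambda>k. x k \<bullet> r)" unfolding corr_def by (rule Max_in) auto
  then show ?thesis by force
qed

lemma active_nonempty: "active r \<noteq> {}"
  using corr_attained by (auto simp: active_def)

lemma corr_eqI: "(\<And>k. x k \<bullet> r \<le> M) \<Longrightarrow> x k \<bullet> r = M \<Longrightarrow> corr r = M"
  by (metis corr_attained inner_le_corr order_antisym)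

lemma corr_nonneg: "0 \<le> corr r"
proof -
  obtain k where k: "x k \<bullet> r = corr r" using corr_attained by blast
  obtain k' where "x k' = - x k" using neg_predictor by blast
  then show ?thesis using inner_le_corr[of k' r] k by simp
qed

lemma corr_eq_0_iff: "corr r = 0 \<longleftrightarrow> (\<forall>k. x k \<bullet> r = 0)"
proof
  assume 0: "corr r = 0"
  show "\<forall>k. x k \<bullet> r = 0"
  proof
    fix k
    obtain k' where "x k' = - x k" using neg_predictor by blast
    then show "x k \<bullet> r = 0"
      using inner_le_corr[of k' r] inner_le_corr[of k r] 0 by simp
  qed
qed (metis corr_attained)

lemma weightsD:
  assumes "c \<in> weights A"
  shows "0 \<le> c $ k" "k \<notin> A \<Longrightarrow> c $ k = 0" "(\<Sum>k\<in>UNIV. c $ k) = 1"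
  using assms by (auto simp: weights_def)

lemma comb_inner_ge:
  assumes c: "c \<in> weights A" and ge: "\<And>k. k \<in> A \<Longrightarrow> d \<le> x k \<bullet> v"
  shows "d \<le> comb c \<bullet> v"
proof -
  have "d = (\<Sum>k\<in>UNIV. c $ k * d)"
    using weightsD(3)[OF c] by (simp add: sum_distrib_right[symmetric])
  also have "\<dots> \<le> comb c \<bullet> v"
    unfolding inner_comb
  proof (rule sum_mono)
    fix k show "c $ k * d \<le> c $ k * (x k \<bullet> v)"
      using weightsD(1,2)[OF c, of k] ge[of k] by (cases "k \<in> A") (auto intro: mult_left_mono)
  qed
  finally show ?thesis .
qed

lemma comb_inner_le:
  assumes "c \<in> weights A" "\<And>k. k \<in> A \<Longrightarrow> x k \<bullet> v \<le> d"
  shows "comb c \<bullet> v \<le> d"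
  using comb_inner_ge[of c A "- d" "- v"] assms by simp

lemma comb_inner_le_corr: "c \<in> weights A \<Longrightarrow> comb c \<bullet> r \<le> corr r"
  by (rule comb_inner_le) (auto intro: inner_le_corr)

lemma comb_inner_active: "c \<in> weights (active r) \<Longrightarrow> comb c \<bullet> r = corr r"
  by (rule antisym[OF comb_inner_le comb_inner_ge]) (auto simp: active_def)

lemma norm_comb_le:
  assumes "c \<in> weights A"
  shows "norm (comb c) \<le> (\<Sum>k\<in>UNIV. norm (x k))"
proof -
  have le1: "c $ k \<le> 1" for k
    using member_le_sum[of k UNIV "\<lambda>k. c $ k"] weightsD[OF assms] by simp
  have "norm (comb c) \<le> (\<Sum>k\<in>UNIV. norm (c $ k *\<^sub>R x k))"
    unfolding comb_def by (rule norm_sum)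
  also have "\<dots> \<le> (\<Sum>k\<in>UNIV. norm (x k))"
    by (rule sum_mono) (use weightsD(1)[OF assms] le1 in \<open>auto intro: mult_left_le_one_le\<close>)
  finally show ?thesis .
qed

lemma norm_weights_le: "c \<in> weights A \<Longrightarrow> norm c \<le> 1"
  using norm_le_l1_cart[of c] weightsD[of c A] by simp

section \<open>The simplex of weights and its points of least norm\<close>

lemma convex_weights: "convex (weights A)"
  unfolding convex_def weights_def
  by (auto simp: sum.distrib sum_distrib_left[symmetric])

lemma compact_weights: "compact (weights A)"
proof -
  have eq: "weights A = (\<Inter>k. {c. 0 \<le> c $ k}) \<inter> (\<Inter>k\<in>-A. {c. c $ k = 0}) \<inter> {c. (\<Sum>k\<in>UNIV. c $ k) = 1}"
    by (auto simp: weights_def)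
  have "closed (weights A)"
    unfolding eq
    by (intro closed_Int closed_INT ballI closed_Collect_le closed_Collect_eq continuous_intros)
  moreover have "bounded (weights A)"
    by (rule boundedI[of _ 1]) (rule norm_weights_le)
  ultimately show ?thesis by (simp add: compact_eq_bounded_closed)
qed

lemma axis_in_weights: "k \<in> A \<Longrightarrow> axis k 1 \<in> weights A"
  by (auto simp: weights_def axis_def)

text \<open>Project the origin onto the compact convex hull of the predictors in \<open>A\<close>;
  the variational inequality of the projection, tested at the vertices \<open>x k\<close>, is the
  required condition.\<close>

lemma steepest_exists:
  assumes "A \<noteq> {}"
  shows "\<exists>c. steepest A c"
proof -
  let ?C = "comb ` weights A"
  have "convex ?C" by (intro convex_linear_image linear_comb convex_weights)
  moreover have "compact ?C"
    by (intro compact_continuous_image linear_continuous_on bounded_linear_comb compact_weights)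
  moreover have "?C \<noteq> {}" using assms axis_in_weights by blast
  ultimately obtain z where z: "z \<in> ?C" "\<forall>w\<in>?C. dist 0 z \<le> dist 0 w" "convex ?C" "closed ?C"
    using distance_attains_inf[of ?C 0] compact_imp_closed by metis
  from z(1) obtain c where c: "c \<in> weights A" "z = comb c" by auto
  have "comb c \<bullet> comb c \<le> x k \<bullet> comb c" if "k \<in> A" for k
  proof -
    have "x k \<in> ?C" using axis_in_weights[OF that] comb_axis[of k 1] by force
    from any_closest_point_dot[OF z(3,4) z(1) this z(2)] show ?thesis
      by (simp add: c(2) inner_diff_right inner_commute)
  qed
  then show ?thesis using c(1) by (auto simp: steepest_def)
qed

text \<open>Complementary slackness: the slacks are non-negative on \<open>A\<close>, and their
  average under the weights \<open>c\<close> vanishes.\<close>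

lemma steepest_slack:
  assumes c: "steepest A c" and "c $ k \<noteq> 0"
  shows "x k \<bullet> comb c = comb c \<bullet> comb c"
proof -
  let ?f = "\<lambda>k. c $ k * (x k \<bullet> comb c - comb c \<bullet> comb c)"
  have w: "c \<in> weights A" using c by (simp add: steepest_def)
  have "(\<Sum>k\<in>UNIV. ?f k) = 0"
    using inner_comb[of c "comb c"] weightsD(3)[OF w]
    by (simp add: right_diff_distrib sum_subtractf sum_distrib_right[symmetric])
  moreover have "0 \<le> ?f k" for k
    using c weightsD(1,2)[OF w, of k] by (cases "k \<in> A") (auto simp: steepest_def)
  ultimately have "?f k = 0"
    by (simp add: sum_nonneg_eq_0_iff)
  then show ?thesis using assms(2) by simp
qed

lemma steepest_comb_le:
  assumes "steepest A c" "c' \<in> weights A"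
  shows "comb c \<bullet> comb c \<le> comb c' \<bullet> comb c"
  using assms by (intro comb_inner_ge) (auto simp: steepest_def)

lemma steepest_norm_le:
  assumes "steepest A c" "c' \<in> weights A"
  shows "norm (comb c) \<le> norm (comb c')"
proof (cases "comb c = 0")
  case False
  have "norm (comb c) * norm (comb c) \<le> norm (comb c') * norm (comb c)"
    using steepest_comb_le[OF assms] norm_cauchy_schwarz[of "comb c'" "comb c"]
    by (simp add: power2_norm_eq_inner[symmetric] power2_eq_square)
  then show ?thesis using False by simp
qed simp

text \<open>The least-norm point is unique because optimality bounds the squared distance between
  the two points by the difference of their squared norms. This concerns the point in the hull, not
  its weights.\<close>

lemma steepest_comb_eq:
  assumes c: "steepest A c" and c': "c' \<in> weights A" and le: "norm (comb c') \<le> norm (comb c)"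
  shows "comb c' = comb c"
proof -
  have "(norm (comb c'))\<^sup>2 \<le> (norm (comb c))\<^sup>2" using le by simp
  then have "(comb c' - comb c) \<bullet> (comb c' - comb c) \<le> 0"
    using steepest_comb_le[OF c c']
    by (simp add: inner_diff inner_commute power2_norm_eq_inner)
  then show ?thesis using inner_ge_zero[of "comb c' - comb c"] by (metis antisym inner_eq_zero_iff eq_iff_diff_eq_0)
qed

section \<open>Motion along the least-norm direction, and least squares\<close>

lemma steepest_inner_pos:
  assumes "corr r \<noteq> 0" "c \<in> weights (active r)"
  shows "0 < comb c \<bullet> comb c"
  using comb_inner_active[OF assms(2)] assms(1) by auto

text \<open>Zero maximal correlation makes every predictor active, in particular some
  \<open>x k\<close> together with its negative; both cannot attain a nonzero maximum at
  \<open>r\<close>.\<close>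

lemma subset_active_corr:
  assumes "corr r \<noteq> 0" "active r' \<subseteq> active r"
  shows "corr r' \<noteq> 0"
proof
  assume "corr r' = 0"
  then have "active r' = UNIV" by (auto simp: active_def corr_eq_0_iff)
  then have all: "x k \<bullet> r = corr r" for k using assms(2) by (auto simp: active_def)
  obtain k' where "x k' = - x (undefined::'k)" using neg_predictor by blast
  then show False using all[of k'] all[of undefined] assms(1) by simp
qed

text \<open>Put \<open>q = comb c \<bullet> comb c\<close>. Predictors with positive weight lose
  correlation exactly at rate \<open>q\<close> (\<open>steepest_slack\<close>), the other active
  ones at least as fast, so these may drop out but \<open>c\<close> remains optimal. The maximum
  thus falls linearly until a predictor outside the active set catches up, and \<open>\<tau>\<close>
  is the first such time.\<close>

lemma segment:
  assumes r: "corr r \<noteq> 0" and c: "steepest (active r) c"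
  obtains \<tau> where "0 < \<tau>"
    and "\<And>t. 0 \<le> t \<Longrightarrow> t < \<tau> \<Longrightarrow>
      active (r - t *\<^sub>R comb c) \<subseteq> active r \<and> steepest (active (r - t *\<^sub>R comb c)) c"
    and "c \<in> weights (active (r - \<tau> *\<^sub>R comb c))"
    and "\<exists>k \<in> active (r - \<tau> *\<^sub>R comb c) - active r. x k \<bullet> comb c < comb c \<bullet> comb c"
proof -
  define z where "z = comb c"
  define q where "q = z \<bullet> z"
  have w: "c \<in> weights (active r)" using c by (simp add: steepest_def)
  have q: "0 < q" using steepest_inner_pos[OF r w] by (simp add: q_def z_def)
  define T where "T = {0..} \<inter> (\<Union>k\<in>- active r. {t. corr r - t * q \<le> x k \<bullet> (r - t *\<^sub>R z)})"
  have below: "x k \<bullet> r < corr r" if "k \<notin> active r" for k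
    using that inner_le_corr[of k r] by (auto simp: active_def order_less_le)
  have "closed T"
    unfolding T_def by (intro closed_Int closed_UN ballI closed_Collect_le continuous_intros) auto
  moreover have "bdd_below T" by (auto simp: T_def bdd_below_def)
  \<comment> \<open>At time \<open>corr r / q\<close> the falling level is zero, while the negative
    of an active predictor, inactive at the start, has by then reached a non-negative
    correlation.\<close>
  moreover have "T \<noteq> {}"
  proof -
    obtain k where k: "k \<in> active r" using active_nonempty by blast
    obtain k' where k': "x k' = - x k" using neg_predictor by blast
    have "k' \<notin> active r" using k k' r by (auto simp: active_def)
    moreover have "q \<le> x k \<bullet> z" using c k by (simp add: steepest_def q_def z_def)
    then have "corr r - corr r / q * q \<le> x k' \<bullet> (r - (corr r / q) *\<^sub>R z)"
      using k k' q corr_nonneg[of r] mult_left_mono[of q "x k \<bullet> z" "corr r / q"]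
      by (simp add: active_def inner_diff_right)
    ultimately have "corr r / q \<in> T" using q corr_nonneg[of r] by (auto simp: T_def)
    then show ?thesis by blast
  qed
  ultimately have inT: "Inf T \<in> T" by (intro closed_contains_Inf) auto
  define \<tau> where "\<tau> = Inf T"
  have "0 \<notin> T" using below by (force simp: T_def)
  with inT have pos: "0 < \<tau>" by (auto simp: \<tau>_def T_def order_less_le)
  have off: "x k \<bullet> (r - t *\<^sub>R z) < corr r - t * q" if "k \<notin> active r" "0 \<le> t" "t < \<tau>" for k t
  proof (rule ccontr)
    assume "\<not> ?thesis"
    then have "t \<in> T"
      using that unfolding T_def by (auto simp: not_less simp del: inner_diff_right intro!: bexI[of _ k])
    then show False using cInf_lower[OF _ \<open>bdd_below T\<close>] that(3) by (force simp: \<tau>_def)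
  qed
  \<comment> \<open>By linearity, a predictor strictly above the level at \<open>\<tau>\<close>
    would have met it at an earlier time, against \<open>off\<close>. The value \<open>t\<close>
    below is that meeting time.\<close>
  have off': "x k \<bullet> (r - \<tau> *\<^sub>R z) \<le> corr r - \<tau> * q" if k: "k \<notin> active r" for k
  proof (rule ccontr)
    define d where "d = q - x k \<bullet> z"
    assume "\<not> ?thesis"
    then have gt: "corr r - x k \<bullet> r < \<tau> * d" 
      by (simp add: d_def inner_diff_right algebra_simps)
    have "0 < \<tau> * d" using gt below[OF k] by simp
    then have d: "0 < d" using pos by (simp add: zero_less_mult_iff)
    define t where "t = (corr r - x k \<bullet> r) / d"
    have "0 \<le> t" "t < \<tau>" using d gt below[OF k] by (auto simp: t_def field_simps)
    moreover have "t * d = corr r - x k \<bullet> r" using d by (simp add: t_def)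
    ultimately show False using off[OF k, of t] by (simp add: d_def inner_diff_right algebra_simps)
  qed
  have on: "x k \<bullet> (r - t *\<^sub>R z) \<le> corr r - t * q" if "k \<in> active r" "0 \<le> t" for k t
    using that c mult_left_mono[of q "x k \<bullet> z" t]
    by (simp add: inner_diff_right active_def steepest_def q_def z_def)
  have support: "x k \<bullet> (r - t *\<^sub>R z) = corr r - t * q" if "c $ k \<noteq> 0" for k t
    using steepest_slack[OF c that] that weightsD(2)[OF w, of k]
    by (auto simp: inner_diff_right active_def q_def z_def)
  obtain k0 where k0: "c $ k0 \<noteq> 0" using weightsD(3)[OF w] by (metis sum.neutral zero_neq_one)
  have corr: "corr (r - t *\<^sub>R z) = corr r - t * q" if "0 \<le> t" "t \<le> \<tau>" for t
  proof (rule corr_eqI[OF _ support[OF k0]])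
    fix k show "x k \<bullet> (r - t *\<^sub>R z) \<le> corr r - t * q"
      using on[of k t] off[of k t] off'[of k] that by (cases "k \<in> active r"; cases "t = \<tau>") auto
  qed
  have cw: "c \<in> weights (active (r - t *\<^sub>R z))" if "0 \<le> t" "t \<le> \<tau>" for t
    using w support[of _ t] corr[OF that] by (auto simp: weights_def active_def)
  show ?thesis
  proof (rule that[OF pos])
    fix t assume t: "0 \<le> t" "t < \<tau>"
    then have sub: "active (r - t *\<^sub>R comb c) \<subseteq> active r"
      using off[of _ t] corr[of t] by (fastforce simp: active_def z_def)
    then show "active (r - t *\<^sub>R comb c) \<subseteq> active r \<and> steepest (active (r - t *\<^sub>R comb c)) c"
      using cw[of t] c t by (auto simp: steepest_def z_def)
  next
    show "c \<in> weights (active (r - \<tau> *\<^sub>R comb c))" using cw[of \<tau>] pos by (simp add: z_def)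
    from inT obtain k where k: "k \<notin> active r" "corr r - \<tau> * q \<le> x k \<bullet> (r - \<tau> *\<^sub>R z)"
      by (auto simp: T_def \<tau>_def)
    have eq: "x k \<bullet> (r - \<tau> *\<^sub>R z) = corr r - \<tau> * q" using k off' by force
    then have "k \<in> active (r - \<tau> *\<^sub>R z)" using corr[of \<tau>] pos by (simp add: active_def)
    \<comment> \<open>The entering predictor starts strictly below the level and meets it at
      \<open>\<tau>\<close>, so it loses correlation more slowly than \<open>q\<close>. This
      strictness later forces the least norm to drop.\<close>
    moreover have "\<tau> * (x k \<bullet> z) < \<tau> * q"
      using eq below[OF k(1)] by (simp add: inner_diff_right)
    then have "x k \<bullet> z < q" using pos by simp
    ultimately show "\<exists>k \<in> active (r - \<tau> *\<^sub>R comb c) - active r. x k \<bullet> comb c < comb c \<bullet> comb c"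
      using k(1) by (auto simp: z_def q_def)
  qed
qed

text \<open>Let \<open>s\<close> be the total weight of \<open>\<theta>\<close> and
  \<open>q = comb c \<bullet> comb c\<close>. Then
  \<open>comb \<theta> \<bullet> r = s * corr r\<close>, since only active predictors occur, and
  \<open>comb \<theta>\<close> has squared norm at least \<open>s * (s * q)\<close>. The objective
  is thus bounded below by a quadratic in \<open>s\<close> whose minimum is at
  \<open>s = corr r / q\<close>, the source of the scale factor.\<close>

lemma nnls_optimal:
  assumes r: "corr r \<noteq> 0" and c: "steepest (active r) c"
    and nonneg: "\<And>k. 0 \<le> \<theta> $ k" and off: "\<And>k. k \<notin> active r \<Longrightarrow> \<theta> $ k = 0"
  shows "(norm (r - comb ((corr r / (comb c \<bullet> comb c)) *\<^sub>R c)))\<^sup>2 \<le> (norm (r - comb \<theta>))\<^sup>2"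
proof -
  define q where "q = comb c \<bullet> comb c"
  define s where "s = (\<Sum>k\<in>UNIV. \<theta> $ k)"
  have w: "c \<in> weights (active r)" using c by (simp add: steepest_def)
  have q: "0 < q" unfolding q_def by (rule steepest_inner_pos[OF r w])
  have s: "0 \<le> s" unfolding s_def by (intro sum_nonneg nonneg)
  have "comb \<theta> \<bullet> r = (\<Sum>k\<in>UNIV. \<theta> $ k * corr r)"
    unfolding inner_comb by (rule sum.cong) (use off in \<open>auto simp: active_def\<close>)
  then have vr: "comb \<theta> \<bullet> r = s * corr r" by (simp add: s_def sum_distrib_right)
  have "s * q = (\<Sum>k\<in>UNIV. \<theta> $ k * q)" by (simp add: s_def sum_distrib_right)
  also have "\<dots> \<le> comb \<theta> \<bullet> comb c"
    unfolding inner_comb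
  proof (rule sum_mono)
    fix k show "\<theta> $ k * q \<le> \<theta> $ k * (x k \<bullet> comb c)"
      using nonneg[of k] off[of k] c
      by (cases "k \<in> active r") (auto simp: steepest_def q_def intro: mult_left_mono)
  qed
  finally have vz: "s * q \<le> comb \<theta> \<bullet> comb c" .
  \<comment> \<open>Expanding a square around \<open>s *\<^sub>R comb c\<close>, instead of dividing
    \<open>\<theta>\<close> by \<open>s\<close>, covers \<open>s = 0\<close> as well.\<close>
  have "0 \<le> (comb \<theta> - s *\<^sub>R comb c) \<bullet> (comb \<theta> - s *\<^sub>R comb c)" by (rule inner_ge_zero)
  also have "\<dots> = comb \<theta> \<bullet> comb \<theta> - 2 * (s * (comb \<theta> \<bullet> comb c)) + s * (s * q)"
    by (simp add: inner_diff inner_commute q_def algebra_simps)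
  finally have vv: "s * (s * q) \<le> comb \<theta> \<bullet> comb \<theta>"
    using mult_left_mono[OF vz s] by linarith
  define u where "u = corr r / q"
  have M: "corr r = u * q" using q by (simp add: u_def)
  have "0 \<le> q * (s - u)\<^sup>2" using q by simp
  also have "\<dots> = s * (s * q) - 2 * (s * (u * q)) + u * (u * q)"
    by (simp add: power2_eq_square algebra_simps)
  finally have "- (u * (u * q)) \<le> comb \<theta> \<bullet> comb \<theta> - 2 * (s * (u * q))" using vv by linarith
  moreover have "(norm (r - u *\<^sub>R comb c))\<^sup>2 = r \<bullet> r - u * (u * q)"
    using comb_inner_active[OF w] unfolding power2_norm_eq_inner
    by (simp add: inner_diff inner_commute[of r "comb c"] q_def[symmetric] M)
  moreover have "(norm (r - comb \<theta>))\<^sup>2 = r \<bullet> r - 2 * (s * (u * q)) + comb \<theta> \<bullet> comb \<theta>"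
    unfolding power2_norm_eq_inner by (simp add: inner_diff inner_commute[of r "comb \<theta>"] vr M)
  ultimately show ?thesis
    unfolding q_def[symmetric] u_def[symmetric] comb_simps by linarith
qed

section \<open>Runs as a subgradient method\<close>

text \<open>For a convex, positively homogeneous function such as \<open>corr\<close>, the
  subgradient inequality at \<open>r\<close> splits into these two conditions (test it at multiples
  of \<open>r\<close>).\<close>

definition subgradient :: "'a \<Rightarrow> 'a \<Rightarrow> bool" where
  "subgradient g r \<longleftrightarrow> g \<bullet> r = corr r \<and> (\<forall>s. g \<bullet> s \<le> corr s)"

lemma subgradient_monotone:
  assumes "subgradient g r" "subgradient h s"
  shows "0 \<le> (g - h) \<bullet> (r - s)"
proof -
  have "g \<bullet> s \<le> corr s" "h \<bullet> r \<le> corr r" using assms by (auto simp: subgradient_def)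
  moreover have "g \<bullet> r = corr r" "h \<bullet> s = corr s" using assms by (auto simp: subgradient_def)
  ultimately show ?thesis by (simp add: inner_diff)
qed

lemma subgradient_comb: "c \<in> weights (active r) \<Longrightarrow> subgradient (comb c) r"
  by (auto simp: subgradient_def comb_inner_active comb_inner_le_corr)

lemma subgradient_0: "corr r = 0 \<Longrightarrow> subgradient 0 r"
  by (simp add: subgradient_def corr_nonneg)

definition total_norm :: real where
  "total_norm = (\<Sum>k\<in>UNIV. norm (x k))"

lemma total_norm_nonneg: "0 \<le> total_norm"
  by (simp add: total_norm_def sum_nonneg)

definition run :: "'a \<Rightarrow> real \<Rightarrow> (nat \<Rightarrow> real ^ 'k) \<Rightarrow> (nat \<Rightarrow> 'a) \<Rightarrow> bool" where
  "run y \<epsilon> b r \<longleftrightarrow> b 0 = 0 \<and> r 0 = y \<and>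
     (\<forall>m. if corr (r m) = 0 then b (Suc m) = b m \<and> r (Suc m) = r m
          else \<exists>k\<in>active (r m). b (Suc m) = b m + axis k \<epsilon> \<and> r (Suc m) = r m - \<epsilon> *\<^sub>R x k)"

lemma run_cases:
  assumes "run y \<epsilon> b r"
  obtains "corr (r m) = 0" "b (Suc m) = b m" "r (Suc m) = r m"
  | k where "k \<in> active (r m)" "b (Suc m) = b m + axis k \<epsilon>" "r (Suc m) = r m - \<epsilon> *\<^sub>R x k"
  using assms unfolding run_def by (metis (full_types))

text \<open>A stopped run fits the same scheme: where \<open>corr\<close> vanishes, 0 is a
  subgradient, so the error estimate does not have to distinguish stopping.\<close>

lemma run_subgradient:
  assumes "run y \<epsilon> b r"
  obtains g where "subgradient g (r m)" "norm g \<le> total_norm" "r (Suc m) = r m - \<epsilon> *\<^sub>R g"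
  using assms
proof (cases rule: run_cases[of y \<epsilon> b r m])
  case 1
  then show ?thesis using that[of 0] by (simp add: subgradient_0 total_norm_nonneg)
next
  case (2 k)
  have "axis k 1 \<in> weights (active (r m))" using 2(1) by (rule axis_in_weights)
  from subgradient_comb[OF this] norm_comb_le[OF this] 2(3) show ?thesis
    using that[of "x k"] by (simp add: comb_axis total_norm_def)
qed

lemma run_residual: "run y \<epsilon> b r \<Longrightarrow> r m = y - comb (b m)"
proof (induction m)
  case 0
  then show ?case by (simp add: run_def comb_simps)
next
  case (Suc m)
  from Suc.prems show ?case
    by (cases rule: run_cases[of y \<epsilon> b r m]) (use Suc in \<open>auto simp: comb_simps comb_axis\<close>)
qed

lemma norm_axis_real: "norm (axis k e :: real ^ 'k) = \<bar>e\<bar>"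
  by (simp add: norm_eq_sqrt_inner inner_axis_axis)

lemma norm_run_diff:
  assumes "run y \<epsilon> b r" "0 < \<epsilon>" "m \<le> n"
  shows "norm (b n - b m) \<le> (real n - real m) * \<epsilon>"
  using assms(3)
proof (induction rule: dec_induct)
  case (step n)
  have "norm (b (Suc n) - b n) \<le> \<epsilon>"
    using assms(1)
    by (cases rule: run_cases[of y \<epsilon> b r n]) (use assms(2) in \<open>auto simp: norm_axis_real\<close>)
  then show ?case
    using norm_triangle_ineq[of "b (Suc n) - b n" "b n - b m"] step.IH
    by (simp add: algebra_simps)
qed simp

text \<open>This recovers coefficients from residuals. The weights outside a neighbourhood of
  \<open>c\<close> form a compact set, whose image under \<open>comb\<close> is closed and misses
  \<open>z\<close>; hence \<open>comb (w \<epsilon>)\<close> close to \<open>z\<close> keeps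
  \<open>w \<epsilon>\<close> in the neighbourhood.\<close>

lemma weights_tendsto:
  assumes w: "\<forall>\<^sub>F \<epsilon> in F. w \<epsilon> \<in> weights A" and lim: "((\<lambda>\<epsilon>. comb (w \<epsilon>)) \<longlongrightarrow> z) F"
    and unique: "\<And>c'. c' \<in> weights A \<Longrightarrow> comb c' = z \<Longrightarrow> c' = c"
  shows "(w \<longlongrightarrow> c) F"
proof (rule topological_tendstoI)
  fix S :: "(real ^ 'k) set" assume S: "open S" "c \<in> S"
  have "compact (weights A - S)" by (intro compact_diff compact_weights S)
  then have "closed (comb ` (weights A - S))"
    by (intro compact_imp_closed compact_continuous_image linear_continuous_on bounded_linear_comb)
  moreover have "z \<notin> comb ` (weights A - S)" using unique S(2) by blast
  ultimately have "\<forall>\<^sub>F \<epsilon> in F. comb (w \<epsilon>) \<in> - comb ` (weights A - S)"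
    using topological_tendstoD[OF lim] by blast
  with w show "\<forall>\<^sub>F \<epsilon> in F. w \<epsilon> \<in> S" by eventually_elim blast
qed

text \<open>Active sets cannot gain members under small perturbations. Writing the condition through
  strict inequalities between finitely many inner products, without \<open>corr\<close>, makes
  openness visible.\<close>

lemma open_active_subset: "open {s. corr s \<noteq> 0 \<and> active s \<subseteq> A}"
proof -
  have "{s. corr s \<noteq> 0 \<and> active s \<subseteq> A} =
      (\<Union>k. {s. 0 < x k \<bullet> s}) \<inter> (\<Inter>k\<in>- A. \<Union>j. {s. x k \<bullet> s < x j \<bullet> s})"
  proof (intro equalityI subsetI)
    fix s assume s: "s \<in> {s. corr s \<noteq> 0 \<and> active s \<subseteq> A}"
    obtain k where k: "x k \<bullet> s = corr s" using corr_attained by blast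
    have "0 < corr s" using s corr_nonneg[of s] by simp
    then have "\<exists>k. 0 < x k \<bullet> s" using k by metis
    moreover have "x j \<bullet> s < x k \<bullet> s" if "j \<notin> A" for j
      using that s inner_le_corr[of j s] k by (auto simp: active_def order_less_le)
    ultimately show "s \<in> (\<Union>k. {s. 0 < x k \<bullet> s}) \<inter> (\<Inter>k\<in>- A. \<Union>j. {s. x k \<bullet> s < x j \<bullet> s})"
      by blast
  next
    fix s assume s: "s \<in> (\<Union>k. {s. 0 < x k \<bullet> s}) \<inter> (\<Inter>k\<in>- A. \<Union>j. {s. x k \<bullet> s < x j \<bullet> s})"
    then obtain k where "0 < x k \<bullet> s" by blast
    then have "corr s \<noteq> 0" using inner_le_corr[of k s] by simp
    moreover have "k \<in> A" if "k \<in> active s" for k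
    proof (rule ccontr)
      assume "k \<notin> A"
      then obtain j where "x k \<bullet> s < x j \<bullet> s" using s by auto
      then show False using that inner_le_corr[of j s] by (simp add: active_def)
    qed
    ultimately show "s \<in> {s. corr s \<noteq> 0 \<and> active s \<subseteq> A}" by auto
  qed
  moreover have "open ((\<Union>k. {s. 0 < x k \<bullet> s}) \<inter> (\<Inter>k\<in>- A. \<Union>j. {s. x k \<bullet> s < x j \<bullet> s}))"
    by (intro open_Int open_INT open_UN ballI open_Collect_less continuous_intros) simp
  ultimately show ?thesis by simp
qed

lemma run_increment_weights:
  assumes run: "run y \<epsilon> b r" and "0 < \<epsilon>" "m < n"
    and act: "\<And>i. m \<le> i \<Longrightarrow> i < n \<Longrightarrow> corr (r i) \<noteq> 0 \<and> active (r i) \<subseteq> A"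
  shows "(1 / ((real n - real m) * \<epsilon>)) *\<^sub>R (b n - b m) \<in> weights A"
proof -
  have "(\<forall>k. 0 \<le> (b n - b m) $ k) \<and> (\<forall>k. k \<notin> A \<longrightarrow> (b n - b m) $ k = 0) \<and>
      (\<Sum>k\<in>UNIV. (b n - b m) $ k) = (real n - real m) * \<epsilon>"
    using less_imp_le[OF \<open>m < n\<close>] act
  proof (induction rule: dec_induct)
    case base
    then show ?case by simp
  next
    case (step i)
    then have i: "corr (r i) \<noteq> 0" "active (r i) \<subseteq> A" by simp_all
    then obtain k where k: "k \<in> A" "b (Suc i) = b i + axis k \<epsilon>"
      using run_cases[OF run, of i] by (metis subsetD)
    have IH: "(\<forall>k. 0 \<le> (b i - b m) $ k) \<and> (\<forall>k. k \<notin> A \<longrightarrow> (b i - b m) $ k = 0) \<and>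
      (\<Sum>k\<in>UNIV. (b i - b m) $ k) = (real i - real m) * \<epsilon>"
      by (rule step.IH) (use step.prems in simp)
    have eq: "b (Suc i) - b m = (b i - b m) + axis k \<epsilon>" by (simp add: k(2))
    have "(\<Sum>j\<in>UNIV. axis k \<epsilon> $ j) = \<epsilon>" by (simp add: axis_def)
    then have sum: "(\<Sum>k\<in>UNIV. (b (Suc i) - b m) $ k) = (real i - real m) * \<epsilon> + \<epsilon>"
      unfolding eq using IH by (simp only: vector_add_component sum.distrib)
    show ?case
    proof (intro conjI allI impI)
      fix j
      have "0 \<le> axis k \<epsilon> $ j" using \<open>0 < \<epsilon>\<close> by (simp add: axis_def)
      then show "0 \<le> (b (Suc i) - b m) $ j"
        unfolding eq vector_add_component using IH by (intro add_nonneg_nonneg) blast+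
      assume "j \<notin> A"
      then have "axis k \<epsilon> $ j = 0" "(b i - b m) $ j = 0" using k(1) IH by (auto simp: axis_def)
      then show "(b (Suc i) - b m) $ j = 0"
        unfolding eq vector_add_component by (simp only: add_0)
    qed (simp only: sum, simp add: algebra_simps)
  qed
  then show ?thesis
    using assms(2,3) by (simp add: weights_def sum_distrib_left[symmetric] sum_divide_distrib[symmetric])
qed

end

section \<open>The path as a gradient flow\<close>

text \<open>Uniqueness is required only at residuals of coefficient vectors, which is where
  uniqueness of the least squares fit supplies it.\<close>

locale stagewise_problem = symmetric_predictors x
  for x :: "'k::finite \<Rightarrow> 'a::euclidean_space" +
  fixes y :: 'a
  assumes steepest_unique:
    "corr (y - comb b) \<noteq> 0 \<Longrightarrow> steepest (active (y - comb b)) c \<Longrightarrow>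
      steepest (active (y - comb b)) c' \<Longrightarrow> c = c'"
begin

definition res :: "real ^ 'k \<Rightarrow> 'a" where
  "res b = y - comb b"

definition path :: "real \<Rightarrow> (real \<Rightarrow> real ^ 'k) \<Rightarrow> bool" where
  "path L \<beta> \<longleftrightarrow> 0 \<le> L \<and> continuous_on {0..L} \<beta> \<and> \<beta> 0 = 0 \<and>
     (\<exists>S. finite S \<and> (\<forall>l\<in>{0..L} - S.
        (\<beta> has_vector_derivative direction (res (\<beta> l))) (at l within {0..L})))"

lemma direction_eq:
  assumes "corr (res b) \<noteq> 0" "steepest (active (res b)) c"
  shows "direction (res b) = c"
  using assms steepest_unique[of b] unfolding direction_def res_def by (auto intro!: the_equality)

lemma steepest_direction: "corr (res b) \<noteq> 0 \<Longrightarrow> steepest (active (res b)) (direction (res b))"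
  using steepest_exists[OF active_nonempty, of "res b"] direction_eq by blast

lemma direction_weights:
  "corr (res b) \<noteq> 0 \<Longrightarrow> direction (res b) \<in> weights (active (res b))"
  using steepest_direction by (simp add: steepest_def)

lemma direction_0: "corr r = 0 \<Longrightarrow> direction r = 0"
  by (simp add: direction_def)

lemma norm_direction_le: "norm (direction (res b)) \<le> 1"
  by (cases "corr (res b) = 0") (auto simp: direction_0 intro: norm_weights_le direction_weights)

definition slope :: "real ^ 'k \<Rightarrow> 'a" where
  "slope b = comb (direction (res b))"

lemma subgradient_slope: "subgradient (slope b) (res b)"
  unfolding slope_def
  by (cases "corr (res b) = 0")
    (auto simp: direction_0 comb_simps intro: subgradient_0 subgradient_comb direction_weights)

lemma norm_slope_le: "norm (slope b) \<le> total_norm"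
  unfolding slope_def using norm_comb_le[OF direction_weights, folded total_norm_def]
  by (cases "corr (res b) = 0") (auto simp: direction_0 comb_simps total_norm_nonneg)

lemma pathE:
  assumes "path L \<beta>"
  obtains S where "finite S" "0 \<le> L" "continuous_on {0..L} \<beta>" "\<beta> 0 = 0"
    "\<And>t. t \<in> {0<..<L} - S \<Longrightarrow> (\<beta> has_vector_derivative direction (res (\<beta> t))) (at t)"
    "continuous_on {0..L} (\<lambda>t. res (\<beta> t))"
    "\<And>t. t \<in> {0<..<L} - S \<Longrightarrow> ((\<lambda>t. res (\<beta> t)) has_vector_derivative - slope (\<beta> t)) (at t)"
proof -
  from assms obtain S where S: "finite S" "0 \<le> L" "continuous_on {0..L} \<beta>" "\<beta> 0 = 0"
    "\<forall>l\<in>{0..L} - S. (\<beta> has_vector_derivative direction (res (\<beta> l))) (at l within {0..L})"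
    by (auto simp: path_def)
  have d: "(\<beta> has_vector_derivative direction (res (\<beta> t))) (at t)" if "t \<in> {0<..<L} - S" for t
  proof -
    have "(\<beta> has_vector_derivative direction (res (\<beta> t))) (at t within {0..L})"
      using S(5) that by auto
    moreover have "at t within {0..L} = at t"
      using that by (intro at_within_Icc_at) auto
    ultimately show ?thesis by simp
  qed
  have c: "continuous_on {0..L} (\<lambda>t. res (\<beta> t))"
    unfolding res_def
    by (intro continuous_intros bounded_linear.continuous_on[OF bounded_linear_comb] S(3))
  have "((\<lambda>t. res (\<beta> t)) has_vector_derivative - slope (\<beta> t)) (at t)"
    if "t \<in> {0<..<L} - S" for t
    unfolding res_def slope_def
    using has_vector_derivative_diff[OF has_vector_derivative_const
        bounded_linear.has_vector_derivative[OF bounded_linear_comb d[OF that]], of y]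
    by (simp add: res_def)
  from that[OF S(1-4) d c this] show ?thesis .
qed

section \<open>Uniqueness of the path and distance to the runs\<close>

lemma path_lipschitz:
  assumes "path L \<beta>" "0 \<le> s" "s \<le> t" "t \<le> L"
  shows "norm (\<beta> t - \<beta> s) \<le> t - s" "norm (res (\<beta> t) - res (\<beta> s)) \<le> total_norm * (t - s)"
proof -
  from assms(1) obtain S where S: "finite S" "0 \<le> L" "continuous_on {0..L} \<beta>"
    "\<And>t. t \<in> {0<..<L} - S \<Longrightarrow> (\<beta> has_vector_derivative direction (res (\<beta> t))) (at t)"
    "continuous_on {0..L} (\<lambda>t. res (\<beta> t))"
    "\<And>t. t \<in> {0<..<L} - S \<Longrightarrow> ((\<lambda>t. res (\<beta> t)) has_vector_derivative - slope (\<beta> t)) (at t)"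
    by (rule pathE) (rule that; simp)
  have sub: "{s..t} \<subseteq> {0..L}" using assms by auto
  have "norm (\<beta> t - \<beta> s) \<le> 1 * (t - s)"
    by (rule norm_increment_le[OF S(1) assms(3) continuous_on_subset[OF S(3) sub] S(4)])
      (use assms norm_direction_le in auto)
  then show "norm (\<beta> t - \<beta> s) \<le> t - s" by simp
  show "norm (res (\<beta> t) - res (\<beta> s)) \<le> total_norm * (t - s)"
    by (rule norm_increment_le[OF S(1) assms(3) continuous_on_subset[OF S(5) sub] S(6)])
      (use assms norm_slope_le in auto)
qed

text \<open>By monotonicity the squared distance of the two residual curves cannot increase, so they
  coincide. The direction depends on the residual alone; hence the difference of the coefficient
  curves has derivative zero off a finite set.\<close>

lemma path_unique:
  assumes "path L \<beta>" "path L \<gamma>" "l \<in> {0..L}"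
  shows "\<gamma> l = \<beta> l"
proof -
  from assms(1) obtain S where S: "finite S" "0 \<le> L" "continuous_on {0..L} \<beta>" "\<beta> 0 = 0"
    "\<And>t. t \<in> {0<..<L} - S \<Longrightarrow> (\<beta> has_vector_derivative direction (res (\<beta> t))) (at t)"
    "continuous_on {0..L} (\<lambda>t. res (\<beta> t))"
    "\<And>t. t \<in> {0<..<L} - S \<Longrightarrow> ((\<lambda>t. res (\<beta> t)) has_vector_derivative - slope (\<beta> t)) (at t)"
    by (rule pathE) (rule that; simp)
  from assms(2) obtain T where T: "finite T" "0 \<le> L" "continuous_on {0..L} \<gamma>" "\<gamma> 0 = 0"
    "\<And>t. t \<in> {0<..<L} - T \<Longrightarrow> (\<gamma> has_vector_derivative direction (res (\<gamma> t))) (at t)"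
    "continuous_on {0..L} (\<lambda>t. res (\<gamma> t))"
    "\<And>t. t \<in> {0<..<L} - T \<Longrightarrow> ((\<lambda>t. res (\<gamma> t)) has_vector_derivative - slope (\<gamma> t)) (at t)"
    by (rule pathE) (rule that; simp)
  have fin: "finite (S \<union> T)" using S T by simp
  define e where "e t = res (\<gamma> t) - res (\<beta> t)" for t
  have same: "res (\<gamma> t) = res (\<beta> t)" if t: "t \<in> {0..L}" for t
  proof -
    have "(e t \<bullet> e t) - (e 0 \<bullet> e 0) \<le> 0 * (t - 0)"
    proof (rule increment_le[OF fin])
      show "0 \<le> t" using t by simp
      show "continuous_on {0..t} (\<lambda>t. e t \<bullet> e t)"
        unfolding e_def by (rule continuous_on_subset[of "{0..L}"]) (use S(6) T(6) t in \<open>auto intro!: continuous_intros\<close>)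
      fix s assume s: "s \<in> {0<..<t} - (S \<union> T)"
      have e': "(e has_vector_derivative (- slope (\<gamma> s) - - slope (\<beta> s))) (at s)"
        unfolding e_def by (intro has_vector_derivative_diff S(7) T(7)) (use s t in auto)
      show "((\<lambda>t. e t \<bullet> e t) has_vector_derivative
          (e s \<bullet> (- slope (\<gamma> s) - - slope (\<beta> s)) + (- slope (\<gamma> s) - - slope (\<beta> s)) \<bullet> e s)) (at s)"
        by (rule bounded_bilinear.has_vector_derivative[OF bounded_bilinear_inner e' e'])
      show "e s \<bullet> (- slope (\<gamma> s) - - slope (\<beta> s)) + (- slope (\<gamma> s) - - slope (\<beta> s)) \<bullet> e s \<le> 0"
        using subgradient_monotone[OF subgradient_slope subgradient_slope, of "\<gamma> s" "\<beta> s"]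
        by (simp add: e_def inner_commute inner_diff algebra_simps)
    qed
    then have "e t \<bullet> e t \<le> 0" using S(4) T(4) by (simp add: e_def)
    then have "e t = 0" using inner_eq_zero_iff[of "e t"] inner_ge_zero[of "e t"] by linarith
    then show ?thesis by (simp add: e_def)
  qed
  have "norm ((\<gamma> l - \<beta> l) - (\<gamma> 0 - \<beta> 0)) \<le> 0 * (l - 0)"
  proof (rule norm_increment_le[OF fin])
    show "0 \<le> l" using assms(3) by simp
    show "continuous_on {0..l} (\<lambda>t. \<gamma> t - \<beta> t)"
      by (rule continuous_on_subset[of "{0..L}"]) (use S(3) T(3) assms(3) in \<open>auto intro!: continuous_intros\<close>)
    fix s assume s: "s \<in> {0<..<l} - (S \<union> T)"
    then show "((\<lambda>t. \<gamma> t - \<beta> t) has_vector_derivative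
        (direction (res (\<gamma> s)) - direction (res (\<beta> s)))) (at s)"
      by (intro has_vector_derivative_diff S(5) T(5)) (use assms(3) in auto)
    show "norm (direction (res (\<gamma> s)) - direction (res (\<beta> s))) \<le> 0"
      using same[of s] s assms(3) by simp
  qed
  then show ?thesis using S(4) T(4) by simp
qed

text \<open>Within one step the run is interpolated linearly with its subgradient \<open>g\<close>
  frozen. Monotonicity is available at the grid residual \<open>r m\<close>, and moving to the
  interpolated point costs \<open>(t - s) * (g \<bullet> (g - slope (\<beta> t)))\<close>. In the
  constant 4, one factor 2 comes from differentiating a square, the other from bounding
  \<open>norm (g - slope (\<beta> t))\<close>.\<close>

lemma run_error:
  assumes path: "path L \<beta>" and run: "run y \<epsilon> b r" and \<epsilon>: "0 < \<epsilon>" and "real m * \<epsilon> \<le> L"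
  shows "(norm (r m - res (\<beta> (real m * \<epsilon>))))\<^sup>2 \<le> 4 * total_norm\<^sup>2 * \<epsilon> * (real m * \<epsilon>)"
  using assms(4)
proof (induction m)
  case 0
  have "\<beta> 0 = 0" using path by (simp add: path_def)
  then show ?case using run by (simp add: run_def res_def comb_simps)
next
  case (Suc m)
  define s where "s = real m * \<epsilon>"
  have s: "0 \<le> s" "s \<le> s + \<epsilon>" "s + \<epsilon> \<le> L" "real (Suc m) * \<epsilon> = s + \<epsilon>"
    using Suc.prems \<epsilon> by (auto simp: s_def algebra_simps)
  from path obtain S where S: "finite S"
    "continuous_on {0..L} (\<lambda>t. res (\<beta> t))"
    "\<And>t. t \<in> {0<..<L} - S \<Longrightarrow> ((\<lambda>t. res (\<beta> t)) has_vector_derivative - slope (\<beta> t)) (at t)"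
    by (rule pathE) (rule that; simp)
  from run obtain g where g: "subgradient g (r m)" "norm g \<le> total_norm" "r (Suc m) = r m - \<epsilon> *\<^sub>R g"
    by (rule run_subgradient)
  define e where "e t = r m - (t - s) *\<^sub>R g - res (\<beta> t)" for t
  have "(e (s + \<epsilon>) \<bullet> e (s + \<epsilon>)) - (e s \<bullet> e s) \<le> (4 * total_norm\<^sup>2 * \<epsilon>) * (s + \<epsilon> - s)"
  proof (rule increment_le[OF S(1) s(2)])
    have "continuous_on {s..s + \<epsilon>} (\<lambda>t. res (\<beta> t))"
      by (rule continuous_on_subset[OF S(2)]) (use s in auto)
    then show "continuous_on {s..s + \<epsilon>} (\<lambda>t. e t \<bullet> e t)"
      unfolding e_def by (intro continuous_intros)
    fix t assume t: "t \<in> {s<..<s + \<epsilon>} - S"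
    have e': "(e has_vector_derivative (slope (\<beta> t) - g)) (at t)"
      unfolding e_def
      by (rule derivative_eq_intros refl S(3))+ (use t s in auto)
    show "((\<lambda>t. e t \<bullet> e t) has_vector_derivative (e t \<bullet> (slope (\<beta> t) - g) + (slope (\<beta> t) - g) \<bullet> e t)) (at t)"
      by (rule bounded_bilinear.has_vector_derivative[OF bounded_bilinear_inner e' e'])
    have "0 \<le> (g - slope (\<beta> t)) \<bullet> (r m - res (\<beta> t))"
      by (rule subgradient_monotone[OF g(1) subgradient_slope])
    then have "(slope (\<beta> t) - g) \<bullet> e t \<le> (t - s) * (g \<bullet> (g - slope (\<beta> t)))"
      by (simp add: e_def inner_diff inner_commute algebra_simps)
    also have "\<dots> \<le> (t - s) * (total_norm * (2 * total_norm))"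
    proof (rule mult_left_mono)
      have "norm (g - slope (\<beta> t)) \<le> 2 * total_norm"
        using norm_triangle_ineq4[of g "slope (\<beta> t)"] g(2) norm_slope_le[of "\<beta> t"] by simp
      then have "norm g * norm (g - slope (\<beta> t)) \<le> total_norm * (2 * total_norm)"
        by (intro mult_mono g(2)) (auto simp: total_norm_nonneg)
      then show "g \<bullet> (g - slope (\<beta> t)) \<le> total_norm * (2 * total_norm)"
        using norm_cauchy_schwarz[of g "g - slope (\<beta> t)"] by linarith
    qed (use t in auto)
    also have "\<dots> \<le> \<epsilon> * (total_norm * (2 * total_norm))"
      by (rule mult_right_mono) (use t total_norm_nonneg in auto)
    finally show "e t \<bullet> (slope (\<beta> t) - g) + (slope (\<beta> t) - g) \<bullet> e t \<le> 4 * total_norm\<^sup>2 * \<epsilon>"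
      by (simp add: inner_commute power2_eq_square algebra_simps)
  qed
  moreover have "e s \<bullet> e s \<le> 4 * total_norm\<^sup>2 * \<epsilon> * s"
    unfolding power2_norm_eq_inner[symmetric] using Suc.IH s(2,3) by (simp add: e_def s_def)
  ultimately have "e (s + \<epsilon>) \<bullet> e (s + \<epsilon>) \<le> 4 * total_norm\<^sup>2 * \<epsilon> * (s + \<epsilon>)"
    by (simp add: algebra_simps)
  moreover have "e (s + \<epsilon>) = r (Suc m) - res (\<beta> (s + \<epsilon>))" by (simp add: e_def g(3))
  ultimately show ?case
    unfolding s(4) power2_norm_eq_inner by simp
qed

lemma run_error_at:
  assumes path: "path L \<beta>" and run: "run y \<epsilon> b r" and \<epsilon>: "0 < \<epsilon>" and t: "t \<in> {0..L}"
  shows "norm (r (nat \<lfloor>t / \<epsilon>\<rfloor>) - res (\<beta> t)) \<le> 2 * total_norm * sqrt (\<epsilon> * L) + total_norm * \<epsilon>"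
proof -
  define m where "m = nat \<lfloor>t / \<epsilon>\<rfloor>"
  have t0: "0 \<le> t" using t by simp
  have m: "real m * \<epsilon> \<le> t" "t < real m * \<epsilon> + \<epsilon>"
    unfolding m_def using nat_floor_bounds[OF \<epsilon> t0] .
  have "(norm (r m - res (\<beta> (real m * \<epsilon>))))\<^sup>2 \<le> 4 * total_norm\<^sup>2 * \<epsilon> * (real m * \<epsilon>)"
    by (rule run_error[OF path run \<epsilon>]) (use m t in auto)
  also have "\<dots> \<le> 4 * total_norm\<^sup>2 * \<epsilon> * L"
    by (rule mult_left_mono) (use m t \<epsilon> in auto)
  also have "\<dots> = (2 * total_norm * sqrt (\<epsilon> * L))\<^sup>2"
    using \<epsilon> t by (simp add: power_mult_distrib)
  finally have 1: "norm (r m - res (\<beta> (real m * \<epsilon>))) \<le> 2 * total_norm * sqrt (\<epsilon> * L)"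
    by (rule power2_le_imp_le) (use \<epsilon> t total_norm_nonneg in simp)
  have "norm (res (\<beta> t) - res (\<beta> (real m * \<epsilon>))) \<le> total_norm * (t - real m * \<epsilon>)"
    by (rule path_lipschitz(2)[OF path]) (use m t \<epsilon> in auto)
  also have "\<dots> \<le> total_norm * \<epsilon>"
    by (rule mult_left_mono) (use m total_norm_nonneg in auto)
  finally have 2: "norm (res (\<beta> t) - res (\<beta> (real m * \<epsilon>))) \<le> total_norm * \<epsilon>" .
  have "norm (r m - res (\<beta> t)) \<le>
      norm (r m - res (\<beta> (real m * \<epsilon>))) + norm (res (\<beta> t) - res (\<beta> (real m * \<epsilon>)))"
    by (rule order_trans[OF _ norm_triangle_ineq4]) simp
  then show ?thesis
    unfolding m_def[symmetric] using 1 2 by linarith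
qed

section \<open>The piecewise linear recursion\<close>

text \<open>Stronger than \<open>stagewise_recursion\<close>: the direction is required to stay
  constant up to the next breakpoint although active sets may shrink, which is what turns the
  polygon into a solution of the differential equation.\<close>

definition recursion ::
  "nat \<Rightarrow> (nat \<Rightarrow> real) \<Rightarrow> (real \<Rightarrow> real ^ 'k) \<Rightarrow> bool" where
  "recursion K l \<beta> \<longleftrightarrow>
     \<beta> 0 = 0 \<and> l 0 = 0 \<and> continuous_on UNIV \<beta> \<and> corr (res (\<beta> (l K))) = 0 \<and>
     (\<forall>j<K. corr (res (\<beta> (l j))) \<noteq> 0 \<and> l j < l (Suc j) \<and>
        (\<forall>t\<in>{l j..l (Suc j)}. \<beta> t = \<beta> (l j) + (t - l j) *\<^sub>R direction (res (\<beta> (l j)))) \<and>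
        (\<forall>t\<in>{l j..<l (Suc j)}. active (res (\<beta> t)) \<subseteq> active (res (\<beta> (l j))) \<and>
           direction (res (\<beta> t)) = direction (res (\<beta> (l j)))) \<and>
        \<not> active (res (\<beta> (l (Suc j)))) \<subseteq> active (res (\<beta> (l j))))"

lemma res_add: "res (b + t *\<^sub>R c) = res b - t *\<^sub>R comb c"
  by (simp add: res_def comb_simps algebra_simps)

text \<open>The old direction is still a choice of weights on the new active set, so the least norm
  there is no larger. Equality would make the old point optimal for the new set as well, against the
  entering predictor from \<open>segment\<close>.\<close>

lemma next_breakpoint:
  assumes b: "corr (res b) \<noteq> 0"
  shows "\<exists>\<tau>>0. (\<forall>t. 0 \<le> t \<and> t < \<tau> \<longrightarrow>
        active (res (b + t *\<^sub>R direction (res b))) \<subseteq> active (res b) \<and>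
        direction (res (b + t *\<^sub>R direction (res b))) = direction (res b)) \<and>
      \<not> active (res (b + \<tau> *\<^sub>R direction (res b))) \<subseteq> active (res b) \<and>
      (\<forall>c. steepest (active (res (b + \<tau> *\<^sub>R direction (res b)))) c \<longrightarrow>
        norm (comb c) < norm (slope b))"
proof -
  define d where "d = direction (res b)"
  obtain \<tau> where \<tau>: "0 < \<tau>"
    "\<And>t. 0 \<le> t \<Longrightarrow> t < \<tau> \<Longrightarrow> active (res b - t *\<^sub>R comb d) \<subseteq> active (res b) \<and>
      steepest (active (res b - t *\<^sub>R comb d)) d"
    "d \<in> weights (active (res b - \<tau> *\<^sub>R comb d))"
    "\<exists>k \<in> active (res b - \<tau> *\<^sub>R comb d) - active (res b). x k \<bullet> comb d < comb d \<bullet> comb d"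
    using segment[OF b steepest_direction[OF b]] unfolding d_def by metis
  have "norm (comb c) < norm (comb d)" if c: "steepest (active (res b - \<tau> *\<^sub>R comb d)) c" for c
  proof (rule ccontr)
    assume "\<not> ?thesis"
    then have "comb d = comb c" by (intro steepest_comb_eq[OF c \<tau>(3)]) simp
    then show False using c \<tau>(4) unfolding steepest_def by force
  qed
  moreover have "direction (res (b + t *\<^sub>R d)) = d" if "0 \<le> t" "t < \<tau>" for t
    using \<tau>(2)[OF that] subset_active_corr[OF b] by (intro direction_eq) (auto simp: res_add)
  ultimately show ?thesis
    using \<tau>(1,2,4) unfolding res_add d_def slope_def by (intro exI[of _ \<tau>]) blast
qed

lemma breakpoints_exist:
  "\<exists>K l b. b 0 = 0 \<and> l 0 = 0 \<and> corr (res (b K)) = 0 \<and>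
     (\<forall>j<K. corr (res (b j)) \<noteq> 0 \<and> l j < l (Suc j) \<and>
        b (Suc j) = b j + (l (Suc j) - l j) *\<^sub>R direction (res (b j)) \<and>
        (\<forall>t. 0 \<le> t \<and> t < l (Suc j) - l j \<longrightarrow>
          active (res (b j + t *\<^sub>R direction (res (b j)))) \<subseteq> active (res (b j)) \<and>
          direction (res (b j + t *\<^sub>R direction (res (b j)))) = direction (res (b j))) \<and>
        \<not> active (res (b (Suc j))) \<subseteq> active (res (b j)))"
proof -
  obtain \<tau> where \<tau>: "\<And>b. corr (res b) \<noteq> 0 \<Longrightarrow> \<tau> b > 0 \<and> (\<forall>t. 0 \<le> t \<and> t < \<tau> b \<longrightarrow>
        active (res (b + t *\<^sub>R direction (res b))) \<subseteq> active (res b) \<and>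
        direction (res (b + t *\<^sub>R direction (res b))) = direction (res b)) \<and>
      \<not> active (res (b + \<tau> b *\<^sub>R direction (res b))) \<subseteq> active (res b) \<and>
      (\<forall>c. steepest (active (res (b + \<tau> b *\<^sub>R direction (res b)))) c \<longrightarrow>
        norm (comb c) < norm (slope b))"
    using next_breakpoint by metis
  \<comment> \<open>The iteration is defined for all indices, but \<open>\<tau>\<close> is specified
    only at correlated residuals; the exit index \<open>K\<close> is chosen least so that this
    covers every \<open>j < K\<close>.\<close>
  define b where "b = rec_nat 0 (\<lambda>_ b. b + \<tau> b *\<^sub>R direction (res b))"
  define l where "l n = (\<Sum>j<n. \<tau> (b j))" for n
  have b: "b 0 = 0" "b (Suc j) = b j + \<tau> (b j) *\<^sub>R direction (res (b j))" for j
    by (simp_all add: b_def)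
  have "\<exists>K. corr (res (b K)) = 0"
  proof (rule ccontr)
    assume "\<not> ?thesis"
    then have nz: "corr (res (b j)) \<noteq> 0" for j by simp
    have dec: "norm (slope (b (Suc j))) < norm (slope (b j))" for j
      using \<tau>[OF nz[of j]] steepest_direction[OF nz[of "Suc j"]] by (simp add: b slope_def)
    have "norm (slope (b j)) < norm (slope (b i))" if "i < j" for i j
      using that
    proof (induction rule: strict_inc_induct)
      case (base i)
      then show ?case using dec[of i] by simp
    next
      case (step i)
      then show ?case using dec[of i] by simp
    qed
    moreover have "norm (slope (b j)) = norm (slope (b i))"
      if "active (res (b i)) = active (res (b j))" for i j
      unfolding slope_def
      using steepest_norm_le[OF steepest_direction[OF nz[of i]]] direction_weights[OF nz[of j]]
        steepest_norm_le[OF steepest_direction[OF nz[of j]]] direction_weights[OF nz[of i]] that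
      by (metis antisym)
    ultimately have "inj (\<lambda>j. active (res (b j)))"
      unfolding inj_def by (metis less_irrefl linorder_neqE_nat)
    moreover have "finite (range (\<lambda>j. active (res (b j))))" by simp
    ultimately have "finite (UNIV :: nat set)" by (rule finite_imageD[rotated])
    then show False by simp
  qed
  then obtain K where K: "corr (res (b K)) = 0" "\<And>j. j < K \<Longrightarrow> corr (res (b j)) \<noteq> 0"
    using exists_least_iff[of "\<lambda>K. corr (res (b K)) = 0"] by auto
  have l: "l (Suc j) = l j + \<tau> (b j)" for j by (simp add: l_def)
  show ?thesis
  proof (intro exI[of _ K] exI[of _ l] exI[of _ b] conjI allI impI K)
    show "b 0 = 0" "l 0 = 0" by (simp_all add: b l_def)
    fix j assume "j < K"
    note t = \<tau>[OF K(2)[OF this]]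
    show "l j < l (Suc j)" using t by (simp add: l)
    show "b (Suc j) = b j + (l (Suc j) - l j) *\<^sub>R direction (res (b j))" by (simp add: l b)
    show "\<not> active (res (b (Suc j))) \<subseteq> active (res (b j))" using t by (simp add: b)
    fix s assume "0 \<le> s \<and> s < l (Suc j) - l j"
    then show "active (res (b j + s *\<^sub>R direction (res (b j)))) \<subseteq> active (res (b j))"
      "direction (res (b j + s *\<^sub>R direction (res (b j)))) = direction (res (b j))"
      using t by (simp_all add: l)
  qed
qed

lemma recursion_exists: "\<exists>K l \<beta>. recursion K l \<beta>"
proof -
  from breakpoints_exist obtain K l b where lb: "b 0 = 0" "l 0 = 0" "corr (res (b K)) = 0"
    and seg: "\<forall>j<K. corr (res (b j)) \<noteq> 0 \<and> l j < l (Suc j) \<and>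
        b (Suc j) = b j + (l (Suc j) - l j) *\<^sub>R direction (res (b j)) \<and>
        (\<forall>t. 0 \<le> t \<and> t < l (Suc j) - l j \<longrightarrow>
          active (res (b j + t *\<^sub>R direction (res (b j)))) \<subseteq> active (res (b j)) \<and>
          direction (res (b j + t *\<^sub>R direction (res (b j)))) = direction (res (b j))) \<and>
        \<not> active (res (b (Suc j))) \<subseteq> active (res (b j))"
    by (elim exE conjE)
  have less: "l j < l (Suc j)" if "j < K" for j using seg that by blast
  obtain \<beta> where \<beta>: "\<beta> 0 = 0" "continuous_on UNIV \<beta>"
    "\<And>j t. j < K \<Longrightarrow> t \<in> {l j..l (Suc j)} \<Longrightarrow> \<beta> t = \<beta> (l j) + (t - l j) *\<^sub>R direction (res (b j))"
    using polygonal_curve[of K l "\<lambda>j. direction (res (b j))"] lb(2) less by (metis less_imp_le)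
  have eq: "\<beta> (l j) = b j" if "j \<le> K" for j
    using that
  proof (induction j)
    case (Suc j)
    then have "j < K" "\<beta> (l j) = b j" by auto
    then have "\<beta> (l (Suc j)) = b j + (l (Suc j) - l j) *\<^sub>R direction (res (b j))"
      using \<beta>(3)[of j "l (Suc j)"] less[of j] by simp
    moreover have "b (Suc j) = b j + (l (Suc j) - l j) *\<^sub>R direction (res (b j))"
      using seg \<open>j < K\<close> by blast
    ultimately show ?case by simp
  qed (simp add: lb \<beta>)
  have act: "active (res (\<beta> t)) \<subseteq> active (res (b j)) \<and> direction (res (\<beta> t)) = direction (res (b j))"
    if "j < K" "t \<in> {l j..<l (Suc j)}" for j t
  proof -
    have "\<beta> t = b j + (t - l j) *\<^sub>R direction (res (b j))"
      using \<beta>(3)[of j t] eq[of j] that by simp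
    moreover have "0 \<le> t - l j \<and> t - l j < l (Suc j) - l j" using that by simp
    ultimately show ?thesis using seg that(1) by metis
  qed
  have "recursion K l \<beta>"
    unfolding recursion_def
  proof (intro conjI allI impI ballI)
    show "corr (res (\<beta> (l K))) = 0" using eq[of K] lb(3) by simp
    fix j assume j: "j < K"
    then have eqs: "\<beta> (l j) = b j" "\<beta> (l (Suc j)) = b (Suc j)" using eq by simp_all
    show "corr (res (\<beta> (l j))) \<noteq> 0" "l j < l (Suc j)"
      "\<not> active (res (\<beta> (l (Suc j)))) \<subseteq> active (res (\<beta> (l j)))"
      unfolding eqs using seg j by blast+
    show "\<beta> t = \<beta> (l j) + (t - l j) *\<^sub>R direction (res (\<beta> (l j)))" if "t \<in> {l j..l (Suc j)}" for t
      using \<beta>(3)[OF j that] unfolding eqs .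
    show "active (res (\<beta> t)) \<subseteq> active (res (\<beta> (l j)))"
      "direction (res (\<beta> t)) = direction (res (\<beta> (l j)))" if "t \<in> {l j..<l (Suc j)}" for t
      unfolding eqs using act[OF j that] by blast+
  qed (use lb \<beta> in simp_all)
  then show ?thesis by blast
qed

lemma recursionD:
  assumes "recursion K l \<beta>" "j < K"
  shows "corr (res (\<beta> (l j))) \<noteq> 0" "l j < l (Suc j)"
    "t \<in> {l j..l (Suc j)} \<Longrightarrow> \<beta> t = \<beta> (l j) + (t - l j) *\<^sub>R direction (res (\<beta> (l j)))"
    "t \<in> {l j..<l (Suc j)} \<Longrightarrow> active (res (\<beta> t)) \<subseteq> active (res (\<beta> (l j)))"
    "t \<in> {l j..<l (Suc j)} \<Longrightarrow> direction (res (\<beta> t)) = direction (res (\<beta> (l j)))"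
    "\<not> active (res (\<beta> (l (Suc j)))) \<subseteq> active (res (\<beta> (l j)))"
  using assms unfolding recursion_def by blast+

lemma recursion_mono:
  assumes "recursion K l \<beta>" "i \<le> j" "j \<le> K"
  shows "l i \<le> l j"
  using assms(2,3)
proof (induction rule: dec_induct)
  case (step n)
  then have "l n < l (Suc n)" using recursionD(2)[OF assms(1)] by simp
  then show ?case using step by simp
qed simp

lemma recursion_path:
  assumes rec: "recursion K l \<beta>"
  shows "path (l K) \<beta>"
  unfolding path_def
proof (intro conjI exI[of _ "l ` {..K}"] ballI)
  have l0: "l 0 = 0" using rec by (simp add: recursion_def)
  then show "0 \<le> l K" using recursion_mono[OF rec, of 0 K] by simp
  show "continuous_on {0..l K} \<beta>"
    using rec continuous_on_subset[of UNIV \<beta>] by (auto simp: recursion_def)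
  show "\<beta> 0 = 0" using rec by (simp add: recursion_def)
  fix t assume t: "t \<in> {0..l K} - l ` {..K}"
  then have "t \<noteq> l K" by blast
  then obtain j where j: "j < K" "l j \<le> t" "t < l (Suc j)"
    using breakpoint_interval[of l t K] t l0 by auto
  have "t \<noteq> l j" using t j(1) by auto
  with j have j': "t \<in> {l j<..<l (Suc j)}" by simp
  have "((\<lambda>s. \<beta> (l j) + (s - l j) *\<^sub>R direction (res (\<beta> (l j)))) has_vector_derivative
      direction (res (\<beta> (l j)))) (at t)"
    by (rule derivative_eq_intros refl)+ simp
  then have "(\<beta> has_vector_derivative direction (res (\<beta> (l j)))) (at t)"
    by (rule has_vector_derivative_transform_within_open[OF _ open_greaterThanLessThan j'])
      (rule recursionD(3)[OF rec j(1), symmetric], simp)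
  moreover have "direction (res (\<beta> t)) = direction (res (\<beta> (l j)))"
    by (rule recursionD(5)[OF rec j(1)]) (use j in simp)
  ultimately show "(\<beta> has_vector_derivative direction (res (\<beta> t))) (at t within {0..l K})"
    by (simp add: has_vector_derivative_at_within)
qed simp

lemma recursion_correlated:
  assumes rec: "recursion K l \<beta>" and t: "0 \<le> t" "t < l K"
  shows "corr (res (\<beta> t)) \<noteq> 0"
proof -
  have "l 0 = 0" using rec by (simp add: recursion_def)
  then obtain j where j: "j < K" "l j \<le> t" "t < l (Suc j)"
    using breakpoint_interval[of l t K] t by auto
  show ?thesis
    by (rule subset_active_corr[OF recursionD(1,4)[OF rec j(1)]]) (use j in simp)
qed

section \<open>Convergence of the runs\<close>

lemma run_error_tendsto: "((\<lambda>\<epsilon>. 2 * total_norm * sqrt (\<epsilon> * L) + total_norm * \<epsilon>) \<longlongrightarrow> 0) (at_right 0)"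
  by (rule tendsto_eq_intros refl)+ simp

lemma run_residual_tendsto:
  assumes path: "path L \<beta>" and runs: "\<And>\<epsilon>. 0 < \<epsilon> \<Longrightarrow> run y \<epsilon> (b \<epsilon>) (r \<epsilon>)" and t: "t \<in> {0..L}"
  shows "((\<lambda>\<epsilon>. r \<epsilon> (nat \<lfloor>t / \<epsilon>\<rfloor>)) \<longlongrightarrow> res (\<beta> t)) (at_right 0)"
proof -
  have "((\<lambda>\<epsilon>. r \<epsilon> (nat \<lfloor>t / \<epsilon>\<rfloor>) - res (\<beta> t)) \<longlongrightarrow> 0) (at_right 0)"
  proof (rule Lim_null_comparison[OF _ run_error_tendsto])
    show "\<forall>\<^sub>F \<epsilon> in at_right 0. norm (r \<epsilon> (nat \<lfloor>t / \<epsilon>\<rfloor>) - res (\<beta> t)) \<le>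
        2 * total_norm * sqrt (\<epsilon> * L) + total_norm * \<epsilon>"
      using eventually_at_right_less by eventually_elim (rule run_error_at[OF path runs _ t])
  qed
  then show ?thesis by (simp add: Lim_null[symmetric])
qed

text \<open>Over an interval on which the active sets stay inside \<open>A\<close>, the increment of a run divided by
  the distance stepped is a point of \<^term>\<open>weights A\<close> that \<^term>\<open>comb\<close> maps close to the slope of
  the path; uniqueness of the steepest weights forces it close to the direction of the path.\<close>

lemma run_increment_tendsto:
  assumes path: "path L \<beta>" and runs: "\<And>\<epsilon>. 0 < \<epsilon> \<Longrightarrow> run y \<epsilon> (b \<epsilon>) (r \<epsilon>)"
    and st: "0 \<le> s" "s < t" "t \<le> L" and a: "corr (res a) \<noteq> 0"
    and act: "\<And>p. p \<in> {s..t} \<Longrightarrow> corr (res (\<beta> p)) \<noteq> 0 \<and> active (res (\<beta> p)) \<subseteq> active (res a)"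
    and line: "\<beta> t = \<beta> s + (t - s) *\<^sub>R direction (res a)"
  shows "((\<lambda>\<epsilon>. b \<epsilon> (nat \<lfloor>t / \<epsilon>\<rfloor>) - b \<epsilon> (nat \<lfloor>s / \<epsilon>\<rfloor>)) \<longlongrightarrow> \<beta> t - \<beta> s) (at_right 0)"
proof -
  define A where "A = active (res a)"
  define c where "c = direction (res a)"
  define d where "d \<epsilon> = (real (nat \<lfloor>t / \<epsilon>\<rfloor>) - real (nat \<lfloor>s / \<epsilon>\<rfloor>)) * \<epsilon>" for \<epsilon>
  define w where "w \<epsilon> = (1 / d \<epsilon>) *\<^sub>R (b \<epsilon> (nat \<lfloor>t / \<epsilon>\<rfloor>) - b \<epsilon> (nat \<lfloor>s / \<epsilon>\<rfloor>))" for \<epsilon>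
  have pos: "\<forall>\<^sub>F \<epsilon> in at_right (0::real). 0 < \<epsilon>" by (rule eventually_at_right_less)
  have "((\<lambda>\<epsilon>. real (nat \<lfloor>t / \<epsilon>\<rfloor>) * \<epsilon> - real (nat \<lfloor>s / \<epsilon>\<rfloor>) * \<epsilon>) \<longlongrightarrow> t - s) (at_right 0)"
    by (intro tendsto_diff floor_mult_tendsto) (use st in auto)
  then have d: "(d \<longlongrightarrow> t - s) (at_right 0)"
    by (simp add: d_def[abs_def] left_diff_distrib)
  have d_pos: "\<forall>\<^sub>F \<epsilon> in at_right 0. 0 < d \<epsilon>"
    by (rule order_tendstoD(1)[OF d]) (use st in simp)
  have "continuous_on {0..L} (\<lambda>p. res (\<beta> p))"
    using path by (auto elim: pathE)
  then have "compact ((\<lambda>p. res (\<beta> p)) ` {s..t})"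
    by (intro compact_continuous_image) (use st in \<open>auto elim: continuous_on_subset\<close>)
  moreover have "(\<lambda>p. res (\<beta> p)) ` {s..t} \<subseteq> {u. corr u \<noteq> 0 \<and> active u \<subseteq> A}"
    unfolding A_def using act by blast
  \<comment> \<open>Compactness gives one radius for the whole interval: a run that stays within
    \<open>\<delta>\<close> of the path residuals has its active sets inside
    \<open>A\<close>.\<close>
  ultimately obtain \<delta> where \<delta>: "0 < \<delta>"
    "(\<Union>u\<in>(\<lambda>p. res (\<beta> p)) ` {s..t}. ball u \<delta>) \<subseteq> {u. corr u \<noteq> 0 \<and> active u \<subseteq> A}"
    by (rule compact_subset_open_imp_ball_epsilon_subset[OF _ open_active_subset])
  have w: "\<forall>\<^sub>F \<epsilon> in at_right 0. w \<epsilon> \<in> weights A"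
    using pos d_pos order_tendstoD(2)[OF run_error_tendsto \<delta>(1), of L]
  proof eventually_elim
    case (elim \<epsilon>)
    note run = runs[OF elim(1)]
    let ?m = "nat \<lfloor>s / \<epsilon>\<rfloor>" and ?n = "nat \<lfloor>t / \<epsilon>\<rfloor>"
    have mn: "?m < ?n" using elim(1,2) by (auto simp: d_def zero_less_mult_iff)
    have "corr (r \<epsilon> i) \<noteq> 0 \<and> active (r \<epsilon> i) \<subseteq> A" if i: "?m \<le> i" "i < ?n" for i
    proof -
      \<comment> \<open>Each step index needs a comparison time inside \<open>{s..t}\<close>. The
        grid point \<open>real i * \<epsilon>\<close> serves, except that for the first index it may
        lie just before \<open>s\<close>, where \<open>s\<close> itself is taken.\<close>
      have "\<exists>p\<in>{s..t}. nat \<lfloor>p / \<epsilon>\<rfloor> = i"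
      proof (cases "i = ?m")
        case True
        then show ?thesis using st by (intro bexI[of _ s]) auto
      next
        case False
        have "s < real ?m * \<epsilon> + \<epsilon>" by (rule nat_floor_bounds) (use elim st in auto)
        also have "\<dots> = real (?m + 1) * \<epsilon>" by (simp add: algebra_simps)
        also have "\<dots> \<le> real i * \<epsilon>"
          by (rule mult_right_mono) (use False i elim in auto)
        finally have "s \<le> real i * \<epsilon>" by simp
        moreover have "real i * \<epsilon> \<le> real ?n * \<epsilon>"
          by (rule mult_right_mono) (use i elim in auto)
        moreover have "real ?n * \<epsilon> \<le> t" by (rule nat_floor_bounds) (use elim st in auto)
        moreover have "nat \<lfloor>real i * \<epsilon> / \<epsilon>\<rfloor> = i" using elim by simp
        ultimately show ?thesis by (meson atLeastAtMost_iff order_trans)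
      qed
      then obtain p where p: "p \<in> {s..t}" "nat \<lfloor>p / \<epsilon>\<rfloor> = i" by blast
      have "norm (r \<epsilon> i - res (\<beta> p)) < \<delta>"
        using run_error_at[OF path run elim(1), of p] p st elim(3) by auto
      then have "r \<epsilon> i \<in> ball (res (\<beta> p)) \<delta>" by (simp add: dist_norm norm_minus_commute)
      then show ?thesis using \<delta>(2) p(1) by blast
    qed
    then show ?case
      unfolding w_def d_def by (rule run_increment_weights[OF run elim(1) mn])
  qed
  have "((\<lambda>\<epsilon>. (1 / d \<epsilon>) *\<^sub>R (r \<epsilon> (nat \<lfloor>s / \<epsilon>\<rfloor>) - r \<epsilon> (nat \<lfloor>t / \<epsilon>\<rfloor>))) \<longlongrightarrow>
      (1 / (t - s)) *\<^sub>R (res (\<beta> s) - res (\<beta> t))) (at_right 0)"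
    by (intro tendsto_intros d run_residual_tendsto[OF path runs]) (use st in auto)
  also have "(1 / (t - s)) *\<^sub>R (res (\<beta> s) - res (\<beta> t)) = comb c"
    using st by (simp add: line res_def comb_simps c_def)
  finally have lim: "((\<lambda>\<epsilon>. comb (w \<epsilon>)) \<longlongrightarrow> comb c) (at_right 0)"
  proof (rule Lim_transform_eventually)
    show "\<forall>\<^sub>F \<epsilon> in at_right 0. (1 / d \<epsilon>) *\<^sub>R (r \<epsilon> (nat \<lfloor>s / \<epsilon>\<rfloor>) - r \<epsilon> (nat \<lfloor>t / \<epsilon>\<rfloor>)) = comb (w \<epsilon>)"
      using pos by eventually_elim (simp add: w_def comb_simps run_residual[OF runs])
  qed
  have "c' = c" if "c' \<in> weights A" "comb c' = comb c" for c'
  proof -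
    \<comment> \<open>Apart from membership in \<open>weights A\<close>, \<open>steepest\<close>
      sees the weights only through \<open>comb\<close>, so optimality transfers from
      \<open>c\<close> to \<open>c'\<close>.\<close>
    have "steepest A c'" using that steepest_direction[OF a] by (simp add: steepest_def A_def c_def)
    then show ?thesis using direction_eq[OF a] by (simp add: A_def c_def)
  qed
  from weights_tendsto[OF w lim this] have "(w \<longlongrightarrow> c) (at_right 0)" .
  with d have "((\<lambda>\<epsilon>. d \<epsilon> *\<^sub>R w \<epsilon>) \<longlongrightarrow> (t - s) *\<^sub>R c) (at_right 0)" by (rule tendsto_scaleR)
  then have "((\<lambda>\<epsilon>. d \<epsilon> *\<^sub>R w \<epsilon>) \<longlongrightarrow> \<beta> t - \<beta> s) (at_right 0)" by (simp add: line c_def)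
  then show ?thesis
  proof (rule Lim_transform_eventually)
    show "\<forall>\<^sub>F \<epsilon> in at_right 0. d \<epsilon> *\<^sub>R w \<epsilon> = b \<epsilon> (nat \<lfloor>t / \<epsilon>\<rfloor>) - b \<epsilon> (nat \<lfloor>s / \<epsilon>\<rfloor>)"
      using d_pos by eventually_elim (simp add: w_def)
  qed
qed

text \<open>Equicontinuity of the deviation up to \<open>\<epsilon>\<close>, the rounding error of
  the step counts. It bridges the ends of segments and turns pointwise into uniform
  convergence.\<close>

lemma norm_deviation_diff:
  assumes path: "path L \<beta>" and run: "run y \<epsilon> b r" and \<epsilon>: "0 < \<epsilon>"
    and st: "0 \<le> s" "s \<le> t" "t \<le> L"
  shows "norm ((b (nat \<lfloor>t / \<epsilon>\<rfloor>) - \<beta> t) - (b (nat \<lfloor>s / \<epsilon>\<rfloor>) - \<beta> s)) \<le> 2 * (t - s) + \<epsilon>"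
proof -
  define m n where "m = nat \<lfloor>s / \<epsilon>\<rfloor>" and "n = nat \<lfloor>t / \<epsilon>\<rfloor>"
  have "m \<le> n" unfolding m_def n_def using st \<epsilon> by (intro nat_mono floor_mono divide_right_mono) auto
  then have 1: "norm (b n - b m) \<le> real n * \<epsilon> - real m * \<epsilon>"
    using norm_run_diff[OF run \<epsilon>, of m n] by (simp only: left_diff_distrib)
  have 2: "real n * \<epsilon> \<le> t" unfolding n_def by (rule nat_floor_bounds) (use \<epsilon> st in auto)
  have 3: "s < real m * \<epsilon> + \<epsilon>" unfolding m_def by (rule nat_floor_bounds) (use \<epsilon> st in auto)
  have 4: "norm (b n - b m) \<le> (t - s) + \<epsilon>" using 1 2 3 by linarith
  have "norm ((b n - \<beta> t) - (b m - \<beta> s)) = norm ((b n - b m) - (\<beta> t - \<beta> s))"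
    by (rule arg_cong[where f = norm]) simp
  also have "\<dots> \<le> norm (b n - b m) + norm (\<beta> t - \<beta> s)" by (rule norm_triangle_ineq4)
  also have "\<dots> \<le> ((t - s) + \<epsilon>) + (t - s)"
    by (rule add_mono[OF 4 path_lipschitz(1)[OF path st]])
  finally have "norm ((b n - \<beta> t) - (b m - \<beta> s)) \<le> 2 * (t - s) + \<epsilon>" by simp
  then show ?thesis unfolding m_def n_def .
qed

text \<open>Induction over segments. At \<open>l (Suc j)\<close> a predictor outside the active set
  of the segment is active, so \<open>run_increment_tendsto\<close> is applied strictly inside, and
  the margins at both ends are estimated by \<open>norm_deviation_diff\<close>.\<close>

lemma recursion_run_tendsto:
  assumes rec: "recursion K l \<beta>" and runs: "\<And>\<epsilon>. 0 < \<epsilon> \<Longrightarrow> run y \<epsilon> (b \<epsilon>) (r \<epsilon>)"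
    and j: "j \<le> K" and t: "t \<in> {0..l j}"
  shows "((\<lambda>\<epsilon>. b \<epsilon> (nat \<lfloor>t / \<epsilon>\<rfloor>) - \<beta> t) \<longlongrightarrow> 0) (at_right 0)"
  using j t
proof (induction j arbitrary: t)
  case 0
  have pos: "\<forall>\<^sub>F \<epsilon> in at_right (0::real). 0 < \<epsilon>" by (rule eventually_at_right_less)
  have "t = 0" "\<beta> 0 = 0" using 0 rec by (auto simp: recursion_def)
  have "\<forall>\<^sub>F \<epsilon> in at_right 0. 0 = b \<epsilon> (nat \<lfloor>t / \<epsilon>\<rfloor>) - \<beta> t"
    using pos
  proof eventually_elim
    case (elim \<epsilon>)
    then show ?case using runs[OF elim] \<open>t = 0\<close> \<open>\<beta> 0 = 0\<close> by (simp add: run_def)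
  qed
  then show ?case by (rule Lim_transform_eventually[OF tendsto_const])
next
  case (Suc j)
  then have j: "j < K" by simp
  note path = recursion_path[OF rec]
  define dev where "dev \<epsilon> t = b \<epsilon> (nat \<lfloor>t / \<epsilon>\<rfloor>) - \<beta> t" for \<epsilon> t
  have dev_diff: "norm (dev \<epsilon> q - dev \<epsilon> p) \<le> 2 * (q - p) + \<epsilon>"
    if "0 < \<epsilon>" "0 \<le> p" "p \<le> q" "q \<le> l K" for \<epsilon> p q
    unfolding dev_def by (rule norm_deviation_diff[OF path runs]) (use that in auto)
  have pos: "\<forall>\<^sub>F \<epsilon> in at_right (0::real). 0 < \<epsilon>" by (rule eventually_at_right_less)
  have l: "0 \<le> l j" "l (Suc j) \<le> l K"
    using recursion_mono[OF rec, of 0 j] recursion_mono[OF rec, of "Suc j" K] j rec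
    by (auto simp: recursion_def)
  have inner: "((\<lambda>\<epsilon>. dev \<epsilon> q - dev \<epsilon> p) \<longlongrightarrow> 0) (at_right 0)"
    if pq: "l j < p" "p < q" "q < l (Suc j)" for p q
  proof -
    have "((\<lambda>\<epsilon>. b \<epsilon> (nat \<lfloor>q / \<epsilon>\<rfloor>) - b \<epsilon> (nat \<lfloor>p / \<epsilon>\<rfloor>)) \<longlongrightarrow> \<beta> q - \<beta> p) (at_right 0)"
    proof (rule run_increment_tendsto[OF path runs])
      show "corr (res (\<beta> (l j))) \<noteq> 0" by (rule recursionD[OF rec j])
      show "corr (res (\<beta> u)) \<noteq> 0 \<and> active (res (\<beta> u)) \<subseteq> active (res (\<beta> (l j)))" if "u \<in> {p..q}" for u
        using recursionD(4)[OF rec j, of u] recursion_correlated[OF rec, of u] that pq l by simp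
      have eqs: "\<beta> q = \<beta> (l j) + (q - l j) *\<^sub>R direction (res (\<beta> (l j)))"
        "\<beta> p = \<beta> (l j) + (p - l j) *\<^sub>R direction (res (\<beta> (l j)))"
        by (rule recursionD(3)[OF rec j]; use pq in simp)+
      show "\<beta> q = \<beta> p + (q - p) *\<^sub>R direction (res (\<beta> (l j)))"
        unfolding eqs by (simp add: algebra_simps)
    qed (use pq l in auto)
    then have "((\<lambda>\<epsilon>. (b \<epsilon> (nat \<lfloor>q / \<epsilon>\<rfloor>) - b \<epsilon> (nat \<lfloor>p / \<epsilon>\<rfloor>)) - (\<beta> q - \<beta> p)) \<longlongrightarrow> 0) (at_right 0)"
      by (simp add: Lim_null[symmetric])
    then show ?thesis by (simp add: dev_def algebra_simps)
  qed
  show ?case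
  proof (cases "t \<le> l j")
    case True
    then show ?thesis using Suc.IH[of t] Suc.prems j by simp
  next
    case False
    then have t: "l j < t" "t \<le> l (Suc j)" using Suc.prems by auto
    have base: "((\<lambda>\<epsilon>. dev \<epsilon> (l j)) \<longlongrightarrow> 0) (at_right 0)"
      unfolding dev_def using Suc.IH[of "l j"] j l by simp
    have tri: "norm (p + q + u + v) \<le> norm p + norm q + norm u + norm v" for p q u v :: "real ^ 'k"
      using norm_triangle_ineq[of "p + q + u" v] norm_triangle_ineq[of "p + q" u]
        norm_triangle_ineq[of p q] by linarith
    show ?thesis
      unfolding dev_def[symmetric]
    proof (rule tendstoI)
      fix e :: real assume e: "0 < e"
      \<comment> \<open>With \<open>\<epsilon> < e / 16\<close>, each margin costs less than 3e/16;
        the interior increment and the value at \<open>l j\<close> cost less than e/4 each, in total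
        less than 7e/8. The second bound keeps \<open>l j + h\<close> below
        \<open>t - h\<close>.\<close>
      define h where "h = min (e / 16) ((t - l j) / 3)"
      have h: "0 < h" "h \<le> e / 16" "3 * h \<le> t - l j" using e t by (auto simp: h_def min_def)
      have "((\<lambda>\<epsilon>. dev \<epsilon> (t - h) - dev \<epsilon> (l j + h)) \<longlongrightarrow> 0) (at_right 0)"
        by (rule inner) (use h t in auto)
      from tendstoD[OF this, of "e / 4"] have 1: "\<forall>\<^sub>F \<epsilon> in at_right 0. norm (dev \<epsilon> (t - h) - dev \<epsilon> (l j + h)) < e / 4"
        using e by (simp add: dist_norm)
      have 2: "\<forall>\<^sub>F \<epsilon> in at_right 0. norm (dev \<epsilon> (l j)) < e / 4"
        using tendstoD[OF base, of "e / 4"] e by (simp add: dist_norm)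
      have 3: "\<forall>\<^sub>F \<epsilon> in at_right 0. \<epsilon> < e / 16"
        using order_tendstoD(2)[OF tendsto_ident_at, of 0 "e / 16"] e by simp
      show "\<forall>\<^sub>F \<epsilon> in at_right 0. dist (dev \<epsilon> t) 0 < e"
        using 1 2 3 pos
      proof eventually_elim
        case (elim \<epsilon>)
        have "norm (dev \<epsilon> t - dev \<epsilon> (t - h)) \<le> 2 * (t - (t - h)) + \<epsilon>"
          by (rule dev_diff) (use elim h l t in auto)
        moreover have "norm (dev \<epsilon> (l j + h) - dev \<epsilon> (l j)) \<le> 2 * (l j + h - l j) + \<epsilon>"
          by (rule dev_diff) (use elim h l t in auto)
        moreover have "dev \<epsilon> t = (dev \<epsilon> t - dev \<epsilon> (t - h)) + (dev \<epsilon> (t - h) - dev \<epsilon> (l j + h)) +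
            (dev \<epsilon> (l j + h) - dev \<epsilon> (l j)) + dev \<epsilon> (l j)" by simp
        then have "norm (dev \<epsilon> t) \<le> norm (dev \<epsilon> t - dev \<epsilon> (t - h)) +
            norm (dev \<epsilon> (t - h) - dev \<epsilon> (l j + h)) +
            norm (dev \<epsilon> (l j + h) - dev \<epsilon> (l j)) + norm (dev \<epsilon> (l j))"
          by (rule ssubst[where P = "\<lambda>v. norm v \<le> _"]) (rule tri)
        ultimately show ?case using elim h e by simp
      qed
    qed
  qed
qed

text \<open>Pointwise convergence on a finite net of mesh \<open>e / 8\<close>, extended to the
  times between by \<open>norm_deviation_diff\<close>.\<close>

lemma recursion_run_uniform_limit:
  assumes rec: "recursion K l \<beta>" and runs: "\<And>\<epsilon>. 0 < \<epsilon> \<Longrightarrow> run y \<epsilon> (b \<epsilon>) (r \<epsilon>)"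
  shows "uniform_limit {0..l K} (\<lambda>\<epsilon> t. b \<epsilon> (nat \<lfloor>t / \<epsilon>\<rfloor>)) \<beta> (at_right 0)"
  unfolding uniform_limit_iff
proof (intro allI impI)
  fix e :: real assume e: "0 < e"
  note path = recursion_path[OF rec]
  define dev where "dev \<epsilon> t = b \<epsilon> (nat \<lfloor>t / \<epsilon>\<rfloor>) - \<beta> t" for \<epsilon> t
  obtain T where T: "T \<subseteq> {0..l K}" "finite T" "{0..l K} \<subseteq> (\<Union>t\<in>T. ball t (e / 8))"
    using compactE_image[of "{0..l K}" "{0..l K}" "\<lambda>t. ball t (e / 8)"] e by force
  have "\<forall>\<^sub>F \<epsilon> in at_right 0. \<forall>t\<in>T. norm (dev \<epsilon> t) < e / 4"
  proof (rule eventually_ball_finite[OF T(2)], rule ballI)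
    fix t assume "t \<in> T"
    then have "((\<lambda>\<epsilon>. dev \<epsilon> t) \<longlongrightarrow> 0) (at_right 0)"
      unfolding dev_def using recursion_run_tendsto[OF rec runs order_refl] T(1) by blast
    from tendstoD[OF this, of "e / 4"] show "\<forall>\<^sub>F \<epsilon> in at_right 0. norm (dev \<epsilon> t) < e / 4"
      using e by (simp add: dist_norm)
  qed
  moreover have "\<forall>\<^sub>F \<epsilon> in at_right 0. \<epsilon> < e / 4"
    using order_tendstoD(2)[OF tendsto_ident_at, of 0 "e / 4"] e by simp
  moreover have "\<forall>\<^sub>F \<epsilon> in at_right (0::real). 0 < \<epsilon>" by (rule eventually_at_right_less)
  ultimately show "\<forall>\<^sub>F \<epsilon> in at_right 0. \<forall>t\<in>{0..l K}. dist (b \<epsilon> (nat \<lfloor>t / \<epsilon>\<rfloor>)) (\<beta> t) < e"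
  proof eventually_elim
    case (elim \<epsilon>)
    show ?case
    proof
      fix t assume t: "t \<in> {0..l K}"
      then obtain u where u: "u \<in> T" "dist u t < e / 8" using T(3) by auto
      have diff: "norm (dev \<epsilon> q - dev \<epsilon> p) \<le> 2 * (q - p) + \<epsilon>" if "0 \<le> p" "p \<le> q" "q \<le> l K" for p q
        unfolding dev_def by (rule norm_deviation_diff[OF path runs]) (use that elim in auto)
      have 1: "norm (dev \<epsilon> t - dev \<epsilon> u) \<le> 2 * \<bar>t - u\<bar> + \<epsilon>"
        using diff[of u t] diff[of t u] u t T(1)
        by (cases "u \<le> t") (auto simp: norm_minus_commute)
      have 2: "norm (dev \<epsilon> u) < e / 4" using elim u by blast
      have 3: "2 * \<bar>t - u\<bar> + \<epsilon> < e / 4 + e / 4"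
        using u(2) elim by (simp add: dist_real_def abs_minus_commute)
      have "norm (dev \<epsilon> t) \<le> norm (dev \<epsilon> t - dev \<epsilon> u) + norm (dev \<epsilon> u)"
        using norm_triangle_ineq[of "dev \<epsilon> t - dev \<epsilon> u" "dev \<epsilon> u"] by simp
      also have "\<dots> < (e / 4 + e / 4) + e / 4"
        by (rule add_strict_mono[OF order_le_less_trans[OF 1 3] 2])
      also have "\<dots> < e" using e by simp
      finally have "norm (dev \<epsilon> t) < e" .
      then show "dist (b \<epsilon> (nat \<lfloor>t / \<epsilon>\<rfloor>)) (\<beta> t) < e" by (simp add: dev_def dist_norm)
    qed
  qed
qed

end

section \<open>The expanded predictor matrix\<close>

lemma symmetric_predictors_expand:
  fixes X :: "real ^ 'p ^ 'n"
  shows "symmetric_predictors (\<lambda>k. column k (expand X))"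
proof
  fix k
  show "\<exists>k'. column k' (expand X) = - column k (expand X)"
  proof (cases k)
    case (Inl j)
    then show ?thesis by (intro exI[of _ "Inr j"]) (simp add: expand_def column_def vec_eq_iff)
  next
    case (Inr j)
    then show ?thesis by (intro exI[of _ "Inl j"]) (simp add: expand_def column_def vec_eq_iff)
  qed
qed

theorem proposition1:
  fixes X :: "real ^ 'p ^ 'n" and y :: "real ^ 'n"
  assumes "standardized X" and "mean y = 0" and "nnls_unique X y"
  shows "\<exists>L \<beta>. monotone_lasso_path X y L \<beta> \<and>
           (\<forall>\<gamma>. monotone_lasso_path X y L \<gamma> \<longrightarrow> (\<forall>l\<in>{0..L}. \<gamma> l = \<beta> l)) \<and>
           forward_stagewise_path X y L \<beta> \<and>
           (\<exists>K l \<rho> A. stagewise_recursion X y K l \<rho> A L \<beta>)"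
proof -
  interpret symmetric_predictors "\<lambda>k. column k (expand X)"
    by (rule symmetric_predictors_expand)
  have comb: "comb c = expand X *v c" for c
    by (simp add: comb_def matrix_mult_sum scalar_mult_eq_scaleR)
  then have residual: "residual X y b = y - comb b" for b by (simp add: residual_def)
  have uncorrelated: "uncorrelated X r \<longleftrightarrow> corr r = 0" for r
    unfolding uncorrelated_def corr_eq_0_iff
    by (simp add: vec_eq_iff matrix_vector_mult_def transpose_def column_def inner_vec_def)
  have most: "most_correlated X r = active r" for r
    by (simp add: most_correlated_def active_def corr_def)
  have nnls: "is_nnls X y b ((corr (y - comb b) / (comb c \<bullet> comb c)) *\<^sub>R c)"
    if b: "corr (y - comb b) \<noteq> 0" "steepest (active (y - comb b)) c" for b c
  proof -
    have w: "c \<in> weights (active (y - comb b))" using b(2) by (simp add: steepest_def)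
    define h where "h = corr (y - comb b) / (comb c \<bullet> comb c)"
    have "0 \<le> h" using corr_nonneg by (simp add: h_def)
    then have feasible: "0 \<le> (h *\<^sub>R c) $ k" "k \<notin> active (y - comb b) \<Longrightarrow> (h *\<^sub>R c) $ k = 0" for k
      using weightsD(1,2)[OF w, of k] by simp_all
    have "(norm (y - comb b - comb (h *\<^sub>R c)))\<^sup>2 \<le> (norm (y - comb b - comb \<theta>))\<^sup>2"
      if "\<forall>k\<in>active (y - comb b). 0 \<le> \<theta> $ k" "\<forall>k. k \<notin> active (y - comb b) \<longrightarrow> \<theta> $ k = 0" for \<theta>
    proof -
      have "0 \<le> \<theta> $ k" for k using that by (cases "k \<in> active (y - comb b)") auto
      then show ?thesis unfolding h_def using that(2) by (intro nnls_optimal[OF b]) auto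
    qed
    then show ?thesis
      using feasible
      unfolding is_nnls_def is_arg_min_def active_set_def most residual comb[symmetric] h_def[symmetric]
      by (meson not_less)
  qed
  have at_most_one: "\<exists>\<^sub>\<le>\<^sub>1 \<theta>. is_nnls X y b \<theta>" if "corr (y - comb b) \<noteq> 0" for b
    using assms(3) that by (simp add: nnls_unique_def uncorrelated residual)
  interpret stagewise_problem "\<lambda>k. column k (expand X)" y
  proof
    fix b c c'
    assume b: "corr (y - comb b) \<noteq> 0" "steepest (active (y - comb b)) c"
      "steepest (active (y - comb b)) c'"
    define h where "h c = corr (y - comb b) / (comb c \<bullet> comb c)" for c
    have w: "c \<in> weights (active (y - comb b))" "c' \<in> weights (active (y - comb b))"
      using b by (auto simp: steepest_def)
    have eq: "h c *\<^sub>R c = h c' *\<^sub>R c'"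
      unfolding h_def using at_most_one[OF b(1)] nnls[OF b(1,2)] nnls[OF b(1,3)]
      by (rule Uniq_D)
    have sum: "(\<Sum>k\<in>UNIV. (h c *\<^sub>R c) $ k) = h c" if "c \<in> weights (active (y - comb b))" for c
      using weightsD(3)[OF that] by (simp add: sum_distrib_left[symmetric])
    \<comment> \<open>Weights sum to one, so the total weight of the common fit recovers the scale;
      the two scales agree and can be cancelled.\<close>
    have "h c = h c'" using sum[OF w(1)] sum[OF w(2)] eq by simp
    moreover have "h c \<noteq> 0"
      using b(1) steepest_inner_pos[OF b(1) w(1)] by (simp add: h_def)
    ultimately show "c = c'" using eq by simp
  qed
  have res: "residual X y b = res b" for b by (simp add: residual res_def)
  have \<rho>: "\<rho>_ml X y b = direction (res b)" for b
  proof (cases "corr (res b) = 0")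
    case True
    then show ?thesis by (simp add: \<rho>_ml_def uncorrelated res direction_0)
  next
    case False
    define c where "c = direction (res b)"
    define h where "h = corr (res b) / (comb c \<bullet> comb c)"
    have c: "steepest (active (res b)) c" unfolding c_def by (rule steepest_direction[OF False])
    then have w: "c \<in> weights (active (res b))" by (simp add: steepest_def)
    have h: "h \<noteq> 0" using steepest_inner_pos[OF False w] False by (simp add: h_def)
    \<comment> \<open>\<open>nnls_unique\<close> asserts at most one minimizer; its existence comes
      from the least-norm weights, rescaled.\<close>
    have "is_nnls X y b (h *\<^sub>R c)" using nnls[of b c] False c by (simp add: res_def h_def)
    then have "(THE \<theta>. is_nnls X y b \<theta>) = h *\<^sub>R c"
      using at_most_one[of b] False by (intro the1_equality') (auto simp: res_def)
    moreover have "(\<Sum>k\<in>UNIV. (h *\<^sub>R c) $ k) = h"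
      using weightsD(3)[OF w] by (simp add: sum_distrib_left[symmetric])
    ultimately show ?thesis
      using False h by (simp add: \<rho>_ml_def uncorrelated res Let_def c_def)
  qed
  have path: "monotone_lasso_path X y L \<beta> \<longleftrightarrow> path L \<beta>" for L \<beta>
    by (simp add: monotone_lasso_path_def path_def \<rho>)
  have run: "stagewise_run X y \<epsilon> b r \<longleftrightarrow> run y \<epsilon> b r" for \<epsilon> b r
    by (simp add: stagewise_run_def run_def uncorrelated most)
  obtain K l \<beta> where rec: "recursion K l \<beta>" using recursion_exists by blast
  note P = recursion_path[OF rec]
  have "forward_stagewise_path X y (l K) \<beta>"
    unfolding forward_stagewise_path_def run uncorrelated res
  proof (intro conjI allI impI ballI)
    show "0 \<le> l K" using P by (simp add: path_def)
    show "uniform_limit {0..l K} (\<lambda>\<epsilon> t. b \<epsilon> (nat \<lfloor>t / \<epsilon>\<rfloor>)) \<beta> (at_right 0)"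
      if "\<forall>\<epsilon>>0. run y \<epsilon> (b \<epsilon>) (r \<epsilon>)" for b r
      by (rule recursion_run_uniform_limit[OF rec]) (use that in blast)
    show "corr (res (\<beta> t)) \<noteq> 0" if "t \<in> {0..<l K}" for t
      using recursion_correlated[OF rec] that by simp
    show "corr (res (\<beta> (l K))) = 0" using rec by (simp add: recursion_def)
  qed
  moreover have "stagewise_recursion X y K l (\<lambda>j. direction (res (\<beta> (l j))))
      (\<lambda>j. active (res (\<beta> (l j)))) (l K) \<beta>"
    unfolding stagewise_recursion_def \<rho> active_set_def most res
  proof (intro conjI allI impI ballI refl)
    show "\<beta> 0 = 0" "l 0 = 0" using rec by (simp_all add: recursion_def)
    show "direction (res (\<beta> (l K))) = 0" using rec by (simp add: recursion_def direction_0)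
    fix j assume j: "j < K"
    note D = recursionD[OF rec j]
    show "direction (res (\<beta> (l j))) \<noteq> 0"
      using weightsD(3)[OF direction_weights[OF D(1)]] by auto
    show "l j < l (Suc j)" "\<not> active (res (\<beta> (l (Suc j)))) \<subseteq> active (res (\<beta> (l j)))"
      by (rule D)+
    show "\<beta> t = \<beta> (l j) + (t - l j) *\<^sub>R direction (res (\<beta> (l j)))" if "t \<in> {l j..l (Suc j)}" for t
      by (rule D(3)[OF that])
    show "active (res (\<beta> t)) \<subseteq> active (res (\<beta> (l j)))" if "t \<in> {l j<..<l (Suc j)}" for t
      by (rule D(4)) (use that in simp)
  qed
  ultimately show ?thesis
    using P path_unique[OF P] unfolding path by blast
qed

end
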